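(* Let $q$ be a fixed power of $2$, and for each sign $\epsilon\in\{+,-\}$ let $i_O^{\epsilon}(2n,q)$ denote the number of involutions in $O^{\epsilon}(2n,q)$. Then for each of the two signs, $$\lim_{n \rightarrow \infty} \frac{i_O^{\pm}(2n,q)}{q^{n^2}} = \prod_{i \geq 1} \left(1+\frac{1}{q^{2i-1}}\right).$$
   Context: $O^{\pm}(2n,q)$ are the stabilizers (full isometry groups) of the two types of nondegenerate quadratic forms $\nu$ on a $2n$-dimensional vector space over the field with $q$ elements (nondegenerate meaning that the associated alternating form $(v,w)=\nu(v+w)+\nu(v)+\nu(w)$ is nondegenerate); $O^+(2n,q)$ corresponds to the forms having totally singular subspaces of dimension $n$, and $O^-(2n,q)$ to the forms whose totally singular subspaces have dimension at most $n-1$. "Involution" means an element $g$ with $g^2=1$ (the identity is counted). *)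

theory Defs
  imports "HOL-Analysis.Infinite_Products" "Jordan_Normal_Form.VS_Connect"
begin

hide_type (open) Finite_Cartesian_Product.vec
hide_const (open) Finite_Cartesian_Product.vec Finite_Cartesian_Product.mat

text \<open>
  The space of dimension \<open>N\<close> over the field \<open>'k\<close> is the coordinate space \<open>carrier_vec N\<close>, and
  its linear maps are the \<open>N \<times> N\<close> matrices.  A quadratic form is a function on vectors of which
  only the values on \<open>carrier_vec N\<close> matter.
\<close>

text \<open>
  This is the convention for characteristic 2, the only case of interest here; elsewhere
  one would write \<open>\<nu> (v + w) - \<nu> v - \<nu> w\<close>.
\<close>

definition polar_form :: "('k::field vec \<Rightarrow> 'k) \<Rightarrow> 'k vec \<Rightarrow> 'k vec \<Rightarrow> 'k" where
  "polar_form \<nu> v w = \<nu> (v + w) + \<nu> v + \<nu> w"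

text \<open>The polar form is symmetric, so linearity in the first argument gives bilinearity.\<close>

definition quadratic_form :: "nat \<Rightarrow> ('k::field vec \<Rightarrow> 'k) \<Rightarrow> bool" where
  "quadratic_form N \<nu> \<longleftrightarrow>
     (\<forall>a. \<forall>v \<in> carrier_vec N. \<nu> (a \<cdot>\<^sub>v v) = a ^ 2 * \<nu> v) \<and>
     (\<forall>u \<in> carrier_vec N. \<forall>v \<in> carrier_vec N. \<forall>w \<in> carrier_vec N.
        polar_form \<nu> (u + v) w = polar_form \<nu> u w + polar_form \<nu> v w) \<and>
     (\<forall>a. \<forall>v \<in> carrier_vec N. \<forall>w \<in> carrier_vec N.
        polar_form \<nu> (a \<cdot>\<^sub>v v) w = a * polar_form \<nu> v w)"

definition nondegenerate_quadratic_form :: "nat \<Rightarrow> ('k::field vec \<Rightarrow> 'k) \<Rightarrow> bool" where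
  "nondegenerate_quadratic_form N \<nu> \<longleftrightarrow>
     quadratic_form N \<nu> \<and>
     (\<forall>v \<in> carrier_vec N. (\<forall>w \<in> carrier_vec N. polar_form \<nu> v w = 0) \<longrightarrow> v = 0\<^sub>v N)"

definition totally_singular :: "nat \<Rightarrow> ('k::field vec \<Rightarrow> 'k) \<Rightarrow> 'k vec set \<Rightarrow> bool" where
  "totally_singular N \<nu> U \<longleftrightarrow>
     VectorSpace.subspace class_ring U (module_vec TYPE('k) N) \<and> (\<forall>u \<in> U. \<nu> u = 0)"

definition subspace_dim :: "nat \<Rightarrow> 'k::field vec set \<Rightarrow> nat" where
  "subspace_dim N U = vectorspace.dim class_ring ((module_vec TYPE('k) N)\<lparr>carrier := U\<rparr>)"

datatype form_sign = Plus | Minus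

text \<open>
  Meant for a nondegenerate \<open>\<nu>\<close> on the space of dimension \<open>2 * n\<close>.
  The strict inequality in the minus case is \<open>dim U \<le> n - 1\<close> without truncated
  subtraction; in particular there is no form of minus type for \<open>n = 0\<close>.
\<close>

fun has_sign :: "form_sign \<Rightarrow> nat \<Rightarrow> ('k::field vec \<Rightarrow> 'k) \<Rightarrow> bool" where
  "has_sign Plus n \<nu> \<longleftrightarrow> (\<exists>U. totally_singular (2 * n) \<nu> U \<and> subspace_dim (2 * n) U = n)"
| "has_sign Minus n \<nu> \<longleftrightarrow> (\<forall>U. totally_singular (2 * n) \<nu> U \<longrightarrow> subspace_dim (2 * n) U < n)"

definition orthogonal_group :: "nat \<Rightarrow> ('k::field vec \<Rightarrow> 'k) \<Rightarrow> 'k mat set" where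
  "orthogonal_group N \<nu> =
     {g \<in> carrier_mat N N. invertible_mat g \<and> (\<forall>v \<in> carrier_vec N. \<nu> (g *\<^sub>v v) = \<nu> v)}"

definition involutions :: "nat \<Rightarrow> 'k::field mat set \<Rightarrow> 'k mat set" where
  "involutions N G = {g \<in> G. g * g = 1\<^sub>m N}"

end

theory Submission
  imports Defs "HOL-Library.Function_Algebras"
begin

text \<open>
  Writing \<open>g = 1 + T\<close>, an involution of the orthogonal group is the same as a totally isotropic
  subspace \<open>W\<close> (the image of \<open>T\<close>) with a nondegenerate symmetric bilinear form \<open>b\<close> on \<open>W\<close> such that
  \<open>b w w = \<nu> w\<close>, via \<open>b (T v) (T w) = (v, T w)\<close>.  Bases of \<open>W\<close> turn this into a count of isotropic
  frames and of nondegenerate symmetric matrices with prescribed diagonal.  For a nonzero diagonal the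
  number of such matrices of size \<open>k\<close> is the number of all nondegenerate symmetric matrices of size
  \<open>k - 1\<close>, by taking a Schur complement and using that squaring is bijective on the field.  The
  subspaces on which \<open>\<nu>\<close> vanishes are exponentially rare, so the type of the form does not matter,
  and up to a vanishing error the count divided by \<open>q ^ n\<^sup>2\<close> is the expansion of
  \<open>\<Prod>i<n. 1 + x ^ (2 * i + 1)\<close>, \<open>x = 1 / q\<close>, given by the \<open>q\<close>-binomial theorem.
\<close>

section \<open>Nondegenerate symmetric matrices in characteristic 2\<close>

text \<open>Put \<open>j = n - k\<close>, where \<open>k\<close> is the rank of
  \<open>g - 1\<close>. Up to bounded factors there are
  \<open>q ^ (2 * n * k - k * (k - 1) / 2)\<close> frames, \<open>q ^ (k * (k - 1) / 2)\<close>
  matrices for each frame and \<open>q ^ (k ^ 2)\<close> bases of each \<open>W\<close>. Hence rank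
  \<open>k\<close> contributes the order \<open>q ^ (n ^ 2 - j ^ 2)\<close>, that is, weight
  \<open>x ^ (j ^ 2)\<close> after normalization, and ranks near \<open>n\<close> dominate. The
  remaining factors would form a Gaussian binomial coefficient in \<open>x ^ 2\<close>, but
  \<open>sym_ratio (k - 1) / full_poch k\<close> stands where \<open>1 / even_poch k\<close> is
  wanted. The two agree only in the limit of large \<open>k\<close>, by splitting an Euler product
  into even and odd exponents. For small \<open>k\<close> they differ, but there \<open>j\<close> is
  large and the weight is tiny; Tannery's theorem combines both effects. The number of frames on
  which \<open>\<nu>\<close> vanishes depends on the form. An upper bound suffices: each choice of a
  vector loses at least a quarter of the candidates, and any constant factor below 1 per step would
  serve as well.\<close>

fun num_alt :: "nat \<Rightarrow> nat \<Rightarrow> nat" where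
  "num_alt q 0 = 1"
| "num_alt q (Suc 0) = 0"
| "num_alt q (Suc (Suc k)) = (q ^ Suc k - 1) * q ^ k * num_alt q k"

text \<open>\<open>num_alt q k\<close> and \<open>num_sym q k\<close> will count the nondegenerate
  alternating and symmetric matrices of size \<open>k\<close>. For \<open>num_alt\<close>: a nonzero
  first row, the free part of a second row, and a complement smaller by two. For
  \<open>num_sym\<close>: each nonzero diagonal contributes \<open>num_sym q k\<close>, and the zero
  diagonal gives the alternating matrices.\<close>

fun num_sym :: "nat \<Rightarrow> nat \<Rightarrow> nat" where
  "num_sym q 0 = 1"
| "num_sym q (Suc k) = (q ^ Suc k - 1) * num_sym q k + num_alt q (Suc k)"

locale char_two_field =
  fixes K :: "'k::{field,finite} itself" and q :: nat
  assumes two_eq_0 [simp]: "(2::'k) = 0" and card_K: "CARD('k) = q"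
begin

section \<open>Arithmetic in characteristic 2\<close>

lemma q_ge_2: "q \<ge> 2"
proof -
  have "card {0, 1 :: 'k} \<le> CARD('k)" by (rule card_mono) auto
  then show ?thesis by (simp add: card_K)
qed

lemma add_self [simp]: "(a::'k) + a = 0"
proof -
  have "a + a = 2 * a" by (rule mult_2[symmetric])
  then show ?thesis by simp
qed

lemma diff_eq_add: "(a::'k) - b = a + b"
  by (simp add: diff_conv_add_uminus del: add_uminus_conv_diff)

lemma add_eq_0_iff_eq: "(a::'k) + b = 0 \<longleftrightarrow> a = b"
  by (metis diff_eq_add eq_iff_diff_eq_0)

lemma add_square: "((a::'k) + b)\<^sup>2 = a\<^sup>2 + b\<^sup>2"
proof -
  have "(a + b)\<^sup>2 = a\<^sup>2 + b\<^sup>2 + (a * b + a * b)"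
    by (simp add: power2_eq_square algebra_simps del: add_self)
  then show ?thesis by simp
qed

lemma inj_square: "inj (\<lambda>a::'k. a\<^sup>2)"
proof (rule injI)
  fix a b :: 'k
  assume "a\<^sup>2 = b\<^sup>2"
  then have "(a + b)\<^sup>2 = 0" by (simp add: add_square)
  then show "a = b" by (simp add: add_eq_0_iff_eq)
qed

definition sqrt2 :: "'k \<Rightarrow> 'k" where "sqrt2 = inv_into UNIV (\<lambda>a. a\<^sup>2)"

lemma sqrt2_square [simp]: "sqrt2 (a\<^sup>2) = a"
  unfolding sqrt2_def by (rule inv_f_f[OF inj_square])

lemma square_sqrt2 [simp]: "(sqrt2 a)\<^sup>2 = a"
  unfolding sqrt2_def
  using surj_f_inv_f[OF finite_UNIV_inj_surj[OF _ inj_square]] by simp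

text \<open>Matrices are indexed by a finite set of numbers rather than by an initial segment, so that
  a pivot may sit at any index without permuting rows and columns.\<close>

definition fsupp :: "nat set \<Rightarrow> (nat \<Rightarrow> 'k) set" where
  "fsupp I = {x. \<forall>i. i \<notin> I \<longrightarrow> x i = 0}"

text \<open>A trivial kernel rather than a determinant: kernel equations are what the elimination of
  a pivot transforms directly.\<close>

definition nondeg :: "nat set \<Rightarrow> (nat \<Rightarrow> nat \<Rightarrow> 'k) \<Rightarrow> bool" where
  "nondeg I S \<longleftrightarrow> (\<forall>x. (\<forall>i\<in>I. (\<Sum>j\<in>I. S i j * x j) = 0) \<longrightarrow> (\<forall>i\<in>I. x i = 0))"

text \<open>Entries off \<open>I\<close> are fixed to zero so that each matrix is represented by
  exactly one function and cardinalities count matrices.\<close>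

definition nsym :: "nat set \<Rightarrow> (nat \<Rightarrow> nat \<Rightarrow> 'k) set" where
  "nsym I = {S. (\<forall>i j. S i j = S j i) \<and> (\<forall>i j. i \<notin> I \<longrightarrow> S i j = 0) \<and> nondeg I S}"

definition nsym_diag :: "nat set \<Rightarrow> (nat \<Rightarrow> 'k) \<Rightarrow> (nat \<Rightarrow> nat \<Rightarrow> 'k) set" where
  "nsym_diag I d = {S \<in> nsym I. \<forall>i\<in>I. S i i = d i}"

lemma nsym_sym: "S \<in> nsym I \<Longrightarrow> S i j = S j i"
  by (simp add: nsym_def)

lemma nsym_outside: "S \<in> nsym I \<Longrightarrow> i \<notin> I \<or> j \<notin> I \<Longrightarrow> S i j = 0"
  using nsym_sym[of S I i j] by (auto simp: nsym_def)

lemma card_fsupp: assumes "finite I" shows "finite (fsupp I)" "card (fsupp I) = q ^ card I"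
proof -
  have b: "bij_betw (\<lambda>x. restrict x I) (fsupp I) (I \<rightarrow>\<^sub>E UNIV)"
    by (rule bij_betw_byWitness[where f' = "\<lambda>x i. if i \<in> I then x i else 0"])
       (auto simp: fsupp_def fun_eq_iff PiE_def extensional_def)
  have "finite (I \<rightarrow>\<^sub>E (UNIV :: 'k set))" using assms by (intro finite_PiE) auto
  then show "finite (fsupp I)" using bij_betw_finite[OF b] by simp
  show "card (fsupp I) = q ^ card I"
    using bij_betw_same_card[OF b] assms by (simp add: card_PiE card_K)
qed

lemma nondegD:
  "nondeg I S \<Longrightarrow> (\<And>i. i \<in> I \<Longrightarrow> (\<Sum>j\<in>I. S i j * x j) = 0) \<Longrightarrow> i \<in> I \<Longrightarrow> x i = 0"
  unfolding nondeg_def by blast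

lemma nondeg_cong:
  assumes "\<And>i j. i \<in> I \<Longrightarrow> j \<in> I \<Longrightarrow> S i j = S' i j"
  shows "nondeg I S \<longleftrightarrow> nondeg I S'"
  using assms by (simp add: nondeg_def)

lemma finite_nsym: assumes "finite I" shows "finite (nsym I)"
proof (rule finite_subset)
  show "finite {S. \<forall>i. (i \<in> I \<longrightarrow> S i \<in> fsupp I) \<and> (i \<notin> I \<longrightarrow> S i = (\<lambda>_. 0))}"
    using assms card_fsupp(1)[OF assms] by (intro finite_set_of_finite_funs)
  show "nsym I \<subseteq> {S. \<forall>i. (i \<in> I \<longrightarrow> S i \<in> fsupp I) \<and> (i \<notin> I \<longrightarrow> S i = (\<lambda>_. 0))}"
    unfolding nsym_def fsupp_def by (auto, metis)
qed

lemma finite_nsym_diag: "finite I \<Longrightarrow> finite (nsym_diag I d)"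
  by (simp add: nsym_diag_def finite_nsym)

section \<open>Schur complements and the counts they give\<close>

text \<open>Row \<open>i\<close> expresses the coordinate \<open>x i\<close> through the others
  because the pivot is invertible. Substituting it into the other rows leaves the kernel equations
  of the Schur complement, with plus signs in characteristic 2.\<close>

lemma nondeg_Schur:
  assumes I: "finite I" "i \<notin> I" and p: "S i i \<noteq> 0"
  shows "nondeg (insert i I) S \<longleftrightarrow> nondeg I (\<lambda>j l. S j l + S j i * S i l / S i i)"
proof -
  have eq: "(\<Sum>l\<in>I. (S j l + S j i * S i l / S i i) * x l)
      = (\<Sum>l\<in>I. S j l * x l) + S j i / S i i * (\<Sum>l\<in>I. S i l * x l)" for j x
    by (simp add: sum_distrib_left sum.distrib algebra_simps)
  show ?thesis
  proof
    assume L: "nondeg (insert i I) S"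
    show "nondeg I (\<lambda>j l. S j l + S j i * S i l / S i i)"
      unfolding nondeg_def
    proof (intro allI impI)
      fix x :: "nat \<Rightarrow> 'k"
      assume x: "\<forall>j\<in>I. (\<Sum>l\<in>I. (S j l + S j i * S i l / S i i) * x l) = 0"
      \<comment> \<open>The value at \<open>i\<close> is the one that row \<open>i\<close>
        forces.\<close>
      define y where "y = x(i := (\<Sum>l\<in>I. S i l * x l) / S i i)"
      have sy: "(\<Sum>l\<in>insert i I. S j l * y l)
          = (\<Sum>l\<in>I. S j l * x l) + S j i / S i i * (\<Sum>l\<in>I. S i l * x l)" for j
      proof -
        have "(\<Sum>l\<in>I. S j l * y l) = (\<Sum>l\<in>I. S j l * x l)"
          by (rule sum.cong) (use I in \<open>auto simp: y_def\<close>)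
        then show ?thesis using I by (simp add: y_def algebra_simps)
      qed
      have "\<forall>j\<in>insert i I. (\<Sum>l\<in>insert i I. S j l * y l) = 0"
        using x p by (auto simp: sy eq)
      then have "\<forall>j\<in>insert i I. y j = 0" using L unfolding nondeg_def by blast
      then show "\<forall>j\<in>I. x j = 0" using I by (auto simp: y_def split: if_splits)
    qed
  next
    assume R: "nondeg I (\<lambda>j l. S j l + S j i * S i l / S i i)"
    show "nondeg (insert i I) S"
      unfolding nondeg_def
    proof (intro allI impI)
      fix x :: "nat \<Rightarrow> 'k"
      assume x: "\<forall>j\<in>insert i I. (\<Sum>l\<in>insert i I. S j l * x l) = 0"
      have xi: "S i i * x i = (\<Sum>l\<in>I. S i l * x l)"
        using x I by (auto simp: add_eq_0_iff_eq)
      have "(\<Sum>l\<in>I. (S j l + S j i * S i l / S i i) * x l) = 0" if "j \<in> I" for j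
      proof -
        have "S j i * x i = (\<Sum>l\<in>I. S j l * x l)"
          using x I that by (auto simp: add_eq_0_iff_eq)
        then show ?thesis using p by (simp add: eq flip: xi)
      qed
      then have "\<forall>j\<in>I. x j = 0" using R unfolding nondeg_def by blast
      then show "\<forall>j\<in>insert i I. x j = 0" using xi p by auto
    qed
  qed
qed

text \<open>The Schur complement has diagonal entries \<open>d j + (S i j)\<^sup>2 / d i\<close>. As
  squaring is bijective, its diagonal recovers row \<open>i\<close> of \<open>S\<close>, so the
  complement may be any nondegenerate symmetric matrix on \<open>I\<close>: the prescribed diagonal
  is traded for the row of the pivot.\<close>

lemma card_nsym_diag_pivot:
  assumes I: "finite I" "i \<notin> I" and p: "d i \<noteq> 0"
  shows "card (nsym_diag (insert i I) d) = card (nsym I)"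
proof -
  define f where "f = (\<lambda>(S :: nat \<Rightarrow> nat \<Rightarrow> 'k) j l. if j \<in> I \<and> l \<in> I then S j l + S i j * S i l / d i else 0)"
  \<comment> \<open>Here \<open>S\<close> is the complement, and \<open>c S j\<close> solves
    \<open>S j j = d j + r\<^sup>2 / d i\<close> for the row entry \<open>r\<close>.\<close>
  define c where "c = (\<lambda>(S :: nat \<Rightarrow> nat \<Rightarrow> 'k) j. sqrt2 (d i * (d j + S j j)))"
  define g where "g = (\<lambda>(S :: nat \<Rightarrow> nat \<Rightarrow> 'k) j l.
      if j \<notin> insert i I \<or> l \<notin> insert i I then 0
      else if j = i then (if l = i then d i else c S l)
      else if l = i then c S j else S j l + c S j * c S l / d i)"
  have fS: "nondeg I (f S) \<longleftrightarrow> nondeg (insert i I) S" if "S i i = d i" "\<And>j l. S j l = S l j" for S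
  proof -
    have "nondeg I (f S) \<longleftrightarrow> nondeg I (\<lambda>j l. S j l + S j i * S i l / S i i)"
    proof (rule nondeg_cong)
      fix j l assume "j \<in> I" "l \<in> I"
      moreover have "S j i = S i j" by (rule that(2))
      ultimately show "f S j l = S j l + S j i * S i l / S i i" by (simp add: f_def that(1))
    qed
    then show ?thesis using nondeg_Schur[of I i S] I p that(1) by simp
  qed
  have fg: "f (g S) = S" if "S \<in> nsym I" for S
  proof -
    have "S j l = 0" if "j \<notin> I \<or> l \<notin> I" for j l
      using nsym_outside \<open>S \<in> nsym I\<close> that by blast
    then show ?thesis using I by (auto simp: f_def g_def fun_eq_iff add.assoc)
  qed
  have gf: "g (f S) = S" if S: "S \<in> nsym_diag (insert i I) d" for S
  proof -
    have sym: "S j l = S l j" for j l using S by (auto simp: nsym_diag_def nsym_def)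
    have z: "S j l = 0" if "j \<notin> insert i I \<or> l \<notin> insert i I" for j l
      using nsym_outside S that by (auto simp: nsym_diag_def)
    have dd: "S j j = d j" if "j \<in> insert i I" for j using S that by (auto simp: nsym_diag_def)
    have cc: "c (f S) j = S i j" if "j \<in> I" for j
    proof -
      have "d i * (d j + f S j j) = (S i j)\<^sup>2"
        using that dd[of j] p
        by (simp add: f_def power2_eq_square flip: add.assoc)
      then show ?thesis unfolding c_def by simp
    qed
    have "g (f S) a b = S a b" for a b
    proof -
      consider "a \<notin> insert i I \<or> b \<notin> insert i I" | "a = i" "b = i" | "a = i" "b \<in> I"
        | "a \<in> I" "b = i" | "a \<in> I" "b \<in> I" by blast
      then show ?thesis
      proof cases
        case 1 then show ?thesis using z[of a b] by (simp add: g_def)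
      next
        case 2 then show ?thesis using dd by (simp add: g_def)
      next
        case 3
        then have "g (f S) a b = c (f S) b" using I by (auto simp: g_def)
        then show ?thesis using 3 cc by simp
      next
        case 4
        then have "g (f S) a b = c (f S) a" using I by (auto simp: g_def)
        then show ?thesis using 4 cc sym[of i a] by simp
      next
        case 5
        then have "a \<noteq> i" "b \<noteq> i" using I by auto
        then show ?thesis using 5 by (simp add: g_def cc) (simp add: f_def add.assoc)
      qed
    qed
    then show ?thesis by blast
  qed
  have "bij_betw f (nsym_diag (insert i I) d) (nsym I)"
  proof (rule bij_betw_byWitness[where f' = g])
    show "f ` nsym_diag (insert i I) d \<subseteq> nsym I"
    proof safe
      fix S assume S: "S \<in> nsym_diag (insert i I) d"
      then have sym: "S j l = S l j" for j l by (auto simp: nsym_diag_def nsym_def)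
      have "nondeg I (f S)" using S fS[of S, OF _ sym] by (auto simp: nsym_diag_def nsym_def)
      moreover have "f S j l = f S l j" for j l
        using sym[of j l] by (simp add: f_def mult.commute)
      moreover have "f S j l = 0" if "j \<notin> I" for j l using that by (simp add: f_def)
      ultimately show "f S \<in> nsym I" unfolding nsym_def by blast
    qed
    show "g ` nsym I \<subseteq> nsym_diag (insert i I) d"
    proof safe
      fix S assume S: "S \<in> nsym I"
      then have sym: "S j l = S l j" for j l by (auto simp: nsym_def)
      have d1: "g S i i = d i" by (simp add: g_def)
      have d2: "g S j j = d j" if "j \<in> I" for j
      proof -
        have "c S j * c S j = d i * (d j + S j j)"
          by (simp add: c_def flip: power2_eq_square)
        then have "g S j j = S j j + (d j + S j j)" using that I p by (auto simp: g_def)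
        also have "\<dots> = d j + (S j j + S j j)" by (simp only: add_ac)
        finally show ?thesis by simp
      qed
      have gsym: "g S j l = g S l j" for j l
        using sym[of j l] by (simp add: g_def mult.commute)
      moreover have "nondeg (insert i I) (g S)"
        using fS[of "g S", OF d1 gsym] S fg[OF S] by (simp add: nsym_def)
      moreover have "g S j l = 0" if "j \<notin> insert i I" for j l using that by (simp add: g_def)
      ultimately show "g S \<in> nsym_diag (insert i I) d"
        unfolding nsym_def nsym_diag_def using d1 d2 by blast
    qed
  qed (use fg gf in auto)
  then show ?thesis by (rule bij_betw_same_card)
qed

text \<open>A zero diagonal offers no pivot of size 1, so the hyperbolic block on
  \<open>{i, j}\<close> is eliminated at once.\<close>

lemma nondeg_Schur2:
  assumes I: "finite I" "i \<notin> I" "j \<notin> I" "i \<noteq> j"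
    and S: "S i i = 0" "S j j = 0" "S i j = p" "S j i = p" and p: "p \<noteq> 0"
  shows "nondeg (insert i (insert j I)) S \<longleftrightarrow>
    nondeg I (\<lambda>l m. S l m + (S l i * S j m + S l j * S i m) / p)"
proof -
  have eq: "(\<Sum>m\<in>I. (S l m + (S l i * S j m + S l j * S i m) / p) * x m)
      = (\<Sum>m\<in>I. S l m * x m) + S l i * ((\<Sum>m\<in>I. S j m * x m) / p)
        + S l j * ((\<Sum>m\<in>I. S i m * x m) / p)" for l x
    by (simp add: sum_distrib_left sum_distrib_right sum_divide_distrib sum.distrib
        algebra_simps add_divide_distrib)
  show ?thesis
  proof
    assume L: "nondeg (insert i (insert j I)) S"
    show "nondeg I (\<lambda>l m. S l m + (S l i * S j m + S l j * S i m) / p)"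
      unfolding nondeg_def
    proof (intro allI impI)
      fix x :: "nat \<Rightarrow> 'k"
      assume x: "\<forall>l\<in>I. (\<Sum>m\<in>I. (S l m + (S l i * S j m + S l j * S i m) / p) * x m) = 0"
      \<comment> \<open>The block is antidiagonal: row \<open>j\<close> forces the coordinate at
        \<open>i\<close>, and row \<open>i\<close> the one at \<open>j\<close>.\<close>
      define y where "y = x(i := (\<Sum>l\<in>I. S j l * x l) / p, j := (\<Sum>l\<in>I. S i l * x l) / p)"
      have sy: "(\<Sum>m\<in>insert i (insert j I). S l m * y m)
          = (\<Sum>m\<in>I. S l m * x m) + S l i * ((\<Sum>m\<in>I. S j m * x m) / p)
        + S l j * ((\<Sum>m\<in>I. S i m * x m) / p)" for l
      proof -
        have "(\<Sum>m\<in>I. S l m * y m) = (\<Sum>m\<in>I. S l m * x m)"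
          by (rule sum.cong) (use I in \<open>auto simp: y_def\<close>)
        then show ?thesis using I by (simp add: y_def algebra_simps)
      qed
      have "\<forall>l\<in>insert i (insert j I). (\<Sum>m\<in>insert i (insert j I). S l m * y m) = 0"
        using x p S by (auto simp only: sy eq insert_iff) auto
      then have "\<forall>l\<in>insert i (insert j I). y l = 0" using L unfolding nondeg_def by blast
      then show "\<forall>l\<in>I. x l = 0" using I by (auto simp: y_def split: if_splits)
    qed
  next
    assume R: "nondeg I (\<lambda>l m. S l m + (S l i * S j m + S l j * S i m) / p)"
    show "nondeg (insert i (insert j I)) S"
      unfolding nondeg_def
    proof (intro allI impI)
      fix x :: "nat \<Rightarrow> 'k"
      assume x: "\<forall>l\<in>insert i (insert j I). (\<Sum>m\<in>insert i (insert j I). S l m * x m) = 0"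
      have x': "S l i * x i + (S l j * x j + (\<Sum>m\<in>I. S l m * x m)) = 0"
        if "l \<in> insert i (insert j I)" for l
        using bspec[OF x that] I by simp
      have xj: "(\<Sum>m\<in>I. S i m * x m) = p * x j"
        using x'[of i] S by (simp add: add_eq_0_iff_eq)
      have xi: "(\<Sum>m\<in>I. S j m * x m) = p * x i"
        using x'[of j] S by (simp add: add_eq_0_iff_eq)
      have "(\<Sum>m\<in>I. (S l m + (S l i * S j m + S l j * S i m) / p) * x m) = 0" if "l \<in> I" for l
        using x'[of l] that p by (simp add: eq xi xj add_ac)
      then have "\<forall>l\<in>I. x l = 0" using R unfolding nondeg_def by blast
      then show "\<forall>l\<in>insert i (insert j I). x l = 0" using xi xj p by auto
    qed
  qed
qed

text \<open>Once row \<open>i\<close> is known, a matrix amounts to the part of row \<open>j\<close>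
  on \<open>I\<close>, which is free, and the Schur complement of the block. The complement is again
  alternating, since the correction to a diagonal entry is a sum of two equal products.\<close>

lemma card_nalt_row:
  assumes I: "finite I" "i \<notin> I" "j \<notin> I" "i \<noteq> j" and p: "c j \<noteq> 0"
    and c: "c \<in> fsupp (insert j I)"
  shows "card {S \<in> nsym_diag (insert i (insert j I)) (\<lambda>_. 0). S i = c}
    = q ^ card I * card (nsym_diag I (\<lambda>_. 0))"
proof -
  let ?J = "insert i (insert j I)"
  let ?A = "{S \<in> nsym_diag ?J (\<lambda>_. 0). S i = c}"
  define f where "f = (\<lambda>S :: nat \<Rightarrow> nat \<Rightarrow> 'k. (\<lambda>m. if m \<in> I then S j m else 0,
      \<lambda>l m. if l \<in> I \<and> m \<in> I then S l m + (S i l * S j m + S j l * S i m) / c j else 0))"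
  define g where "g = (\<lambda>(r, S :: nat \<Rightarrow> nat \<Rightarrow> 'k) a b.
      if a \<notin> ?J \<or> b \<notin> ?J then 0
      else if a = i then c b else if b = i then c a
      else if a = j then r b else if b = j then r a
      else S a b + (c a * r b + r a * c b) / c j)"
  have ci: "c i = 0" using c I by (auto simp: fsupp_def)
  have cz: "c l = 0" if "l \<notin> ?J" for l using c that by (auto simp: fsupp_def)
  have fS: "nondeg I (snd (f S)) \<longleftrightarrow> nondeg ?J S"
    if "S i i = 0" "S j j = 0" "S i j = c j" "S j i = c j" "\<And>a b. S a b = S b a" for S
  proof -
    have "nondeg I (snd (f S)) \<longleftrightarrow> nondeg I (\<lambda>l m. S l m + (S l i * S j m + S l j * S i m) / c j)"
      by (rule nondeg_cong) (simp add: f_def that(5)[of i] that(5)[of j])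
    then show ?thesis using nondeg_Schur2[of I i j S "c j"] I p that by simp
  qed
  have fg: "f (g (r, S)) = (r, S)" if r: "r \<in> fsupp I" and "S \<in> nsym_diag I (\<lambda>_. 0)" for r S
  proof -
    have z: "S j l = 0" if "j \<notin> I \<or> l \<notin> I" for j l
      using nsym_outside \<open>S \<in> _\<close> that by (auto simp: nsym_diag_def)
    have rz: "r l = 0" if "l \<notin> I" for l using r that by (auto simp: fsupp_def)
    have 1: "fst (f (g (r, S))) = r"
      using I rz by (auto simp: f_def g_def fun_eq_iff)
    have "snd (f (g (r, S))) l m = S l m" for l m
      using I z by (auto simp: f_def g_def add.assoc)
    then show ?thesis using 1 by (intro prod_eqI) (auto simp: fun_eq_iff)
  qed
  have props: "S i i = 0" "S j j = 0" "S i j = c j" "S j i = c j" "S i = c" "nondeg ?J S"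
    "\<And>a b. S a b = S b a" "\<And>a b. a \<notin> ?J \<or> b \<notin> ?J \<Longrightarrow> S a b = 0" "\<And>a. S a a = 0" if S: "S \<in> ?A" for S
  proof -
    have sym: "S a b = S b a" for a b using S by (auto simp: nsym_diag_def nsym_def)
    show "S i i = 0" "S j j = 0" "S i j = c j" "S j i = c j" "S i = c" "nondeg ?J S"
      using S sym[of j i] by (auto simp: nsym_diag_def nsym_def)
    show z: "S a b = 0" if "a \<notin> ?J \<or> b \<notin> ?J" for a b
      using nsym_outside S that by (auto simp: nsym_diag_def)
    show "S a a = 0" for a using z[of a a] S by (auto simp: nsym_diag_def)
    show "S a b = S b a" for a b by (rule sym)
  qed
  have gf: "g (f S) = S" if S: "S \<in> ?A" for S
  proof -
    note pr = props[OF S]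
    have ic: "S l i = c l" for l using pr(5) pr(7)[of l i] by simp
    have "g (f S) a b = S a b" for a b
    proof -
      consider "a \<notin> ?J \<or> b \<notin> ?J" | "a = i" "b \<in> ?J" | "a \<in> ?J" "b = i" | "a = j" "b \<in> insert j I"
        | "a \<in> I" "b = j" | "a \<in> I" "b \<in> I" by blast
      then show ?thesis
      proof cases
        case 1 then show ?thesis using pr(8)[of a b] by (simp add: g_def f_def)
      next
        case 2 then show ?thesis using pr(5) cz by (auto simp: g_def f_def)
      next
        case 3 then show ?thesis using ic cz by (auto simp add: g_def f_def pr(5))
      next
        case 4 then show ?thesis using I pr(2) by (auto simp: g_def f_def)
      next
        case 5
        then have "g (f S) a b = S j a" using I by (auto simp: g_def f_def)
        then show ?thesis using 5 pr(7)[of j a] by simp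
      next
        case 6
        then have "a \<noteq> i" "a \<noteq> j" "b \<noteq> i" "b \<noteq> j" using I by auto
        then show ?thesis using 6 by (simp add: g_def f_def pr(5) add.assoc)
      qed
    qed
    then show ?thesis by blast
  qed
  have "bij_betw f ?A (fsupp I \<times> nsym_diag I (\<lambda>_. 0))"
  proof (rule bij_betw_byWitness[where f' = g])
    show "f ` ?A \<subseteq> fsupp I \<times> nsym_diag I (\<lambda>_. 0)"
    proof (rule image_subsetI)
      fix S assume S: "S \<in> ?A"
      note pr = props[OF S]
      have "nondeg I (snd (f S))" using fS[of S] pr by simp
      moreover have "snd (f S) l m = snd (f S) m l" for l m
        using pr(7)[of l m] by (simp add: f_def mult.commute add.commute)
      moreover have "snd (f S) l m = 0" if "l \<notin> I" for l m using that by (simp add: f_def)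
      moreover have "snd (f S) l l = 0" for l
        by (simp add: f_def pr(9) mult.commute)
      moreover have "fst (f S) \<in> fsupp I" by (simp add: f_def fsupp_def)
      ultimately show "f S \<in> fsupp I \<times> nsym_diag I (\<lambda>_. 0)"
        unfolding nsym_diag_def nsym_def mem_Times_iff by blast
    qed
    show "g ` (fsupp I \<times> nsym_diag I (\<lambda>_. 0)) \<subseteq> ?A"
    proof safe
      fix r S assume r: "r \<in> fsupp I" and S: "S \<in> nsym_diag I (\<lambda>_. 0)"
      then have sym: "S j l = S l j" for j l by (auto simp: nsym_def nsym_diag_def)
      have "r j = 0" using r I by (auto simp: fsupp_def)
      then have dz: "g (r, S) a a = 0" for a
        using S ci by (auto simp: g_def nsym_diag_def mult.commute)
      have gsym: "g (r, S) a b = g (r, S) b a" for a b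
        using sym[of a b] by (simp add: g_def mult.commute add.commute)
      moreover have "nondeg ?J (g (r, S))"
      proof (subst fS[symmetric])
        show "g (r, S) i i = 0" "g (r, S) j j = 0" by (rule dz)+
        show "g (r, S) i j = c j" "g (r, S) j i = c j" using I by (auto simp: g_def)
        show "g (r, S) a b = g (r, S) b a" for a b by (rule gsym)
        show "nondeg I (snd (f (g (r, S))))" using fg[OF r S] S by (simp add: nsym_def nsym_diag_def)
      qed
      moreover have "g (r, S) a b = 0" if "a \<notin> ?J" for a b using that by (simp add: g_def)
      ultimately show "g (r, S) \<in> nsym_diag ?J (\<lambda>_. 0)"
        unfolding nsym_def nsym_diag_def using dz by blast
      show "g (r, S) i = c" using cz by (auto simp: g_def fun_eq_iff)
    qed
  qed (use fg gf in auto)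
  then have "card ?A = card (fsupp I \<times> nsym_diag I (\<lambda>_. 0))" by (rule bij_betw_same_card)
  then show ?thesis using I by (simp add: card_cartesian_product card_fsupp)
qed

lemma nsym_diag_empty: "nsym_diag {} d = {\<lambda>_ _. 0}" "nsym {} = {\<lambda>_ _. 0}"
  by (auto simp: nsym_diag_def nsym_def nondeg_def fun_eq_iff)

text \<open>The row of a chosen index \<open>i\<close> vanishes at \<open>i\<close> and is not zero,
  which leaves \<open>q ^ Suc k - 1\<close> rows; each contributes the count for two indices fewer.
  In size 1 the only candidate is the zero matrix, which is degenerate.\<close>

lemma card_nsym_diag_zero: "finite I \<Longrightarrow> card (nsym_diag I (\<lambda>_. 0)) = num_alt q (card I)"
proof (induction "card I" arbitrary: I rule: induct_nat_012)
  case 0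
  then show ?case by (simp add: nsym_diag_empty)
next
  case 1
  then obtain i where I: "I = {i}" by (metis One_nat_def card_1_singletonE)
  have "S \<notin> nsym_diag {i} (\<lambda>_. 0)" for S
  proof
    assume "S \<in> nsym_diag {i} (\<lambda>_. 0)"
    then have "S i i = 0" "nondeg {i} S" by (auto simp: nsym_diag_def nsym_def)
    then have "\<forall>x::nat \<Rightarrow> 'k. x i = 0" by (auto simp: nondeg_def)
    then show False by (auto dest: spec[of _ "\<lambda>_. 1"])
  qed
  then have "nsym_diag I (\<lambda>_. 0) = {}" using I by blast
  then show ?case using 1 by (simp flip: "1.hyps")
next
  case (ge2 k)
  then obtain i where i: "i \<in> I" by fastforce
  define J where "J = I - {i}"
  have J: "I = insert i J" "i \<notin> J" "card J = Suc k" "finite J"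
    using i ge2.prems ge2.hyps(3) by (auto simp: J_def simp flip: ge2.hyps(3))
  let ?Z = "\<lambda>_::nat. 0::'k"
  let ?R = "\<lambda>c. {S \<in> nsym_diag I ?Z. S i = c}"
  have row: "S i \<in> fsupp J - {?Z}" if "S \<in> nsym_diag I ?Z" for S
  proof -
    have sym: "S a b = S b a" and z: "a \<notin> I \<Longrightarrow> S a b = 0" and nd: "nondeg I S" for a b
      using that by (auto simp: nsym_diag_def nsym_def)
    have "S i i = 0" using that J by (auto simp: nsym_diag_def)
    then have "S i l = 0" if "l \<notin> J" for l using that z[of l i] sym[of i l] J by auto
    moreover have "S i \<noteq> ?Z"
    proof
      \<comment> \<open>By symmetry column \<open>i\<close> would vanish too, and the unit vector at
        \<open>i\<close> would lie in the kernel.\<close>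
      assume "S i = ?Z"
      then have "S l i = 0" for l using sym[of l i] by simp
      then have *: "(\<Sum>m\<in>I. S l m * (if m = i then 1 else 0)) = 0" for l
        by (intro sum.neutral) auto
      have "(if i = i then 1 else 0 :: 'k) = 0"
        by (rule nondegD[OF nd]) (use * i in auto)
      then show False by simp
    qed
    ultimately show ?thesis by (auto simp: fsupp_def)
  qed
  have "card (?R c) = q ^ k * num_alt q k" if c: "c \<in> fsupp J - {?Z}" for c
  proof -
    obtain j where j: "c j \<noteq> 0" using c by (auto simp: fun_eq_iff)
    then have jJ: "j \<in> J" using c by (auto simp: fsupp_def)
    define I' where "I' = J - {j}"
    have I': "J = insert j I'" "j \<notin> I'" "finite I'" "card I' = k" "i \<notin> I'" "i \<noteq> j"
      using jJ J by (auto simp: I'_def)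
    have "card {S \<in> nsym_diag (insert i (insert j I')) ?Z. S i = c}
        = q ^ card I' * card (nsym_diag I' ?Z)"
      by (rule card_nalt_row) (use I' j c in auto)
    then show ?thesis using ge2.hyps(1)[of I'] ge2.hyps(3) I' J by auto
  qed
  note cR = this
  have "nsym_diag I ?Z = (\<Union>c\<in>fsupp J - {?Z}. ?R c)" using row by auto
  then have "card (nsym_diag I ?Z) = card (\<Union>c\<in>fsupp J - {?Z}. ?R c)" by simp
  also have "\<dots> = (\<Sum>c\<in>fsupp J - {?Z}. card (?R c))"
    by (rule card_UN_disjoint) (use J card_fsupp finite_nsym_diag in auto)
  also have "\<dots> = card (fsupp J - {?Z}) * (q ^ k * num_alt q k)"
    using cR by simp
  also have "card (fsupp J - {?Z}) = q ^ Suc k - 1"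
    using card_fsupp[OF J(4)] J(3) by (subst card_Diff_singleton) (auto simp: fsupp_def)
  finally show ?case using ge2.hyps(3) by (simp flip: ge2.hyps(3) add: mult_ac)
qed

lemma card_nsym: "finite I \<Longrightarrow> card (nsym I) = num_sym q (card I)"
proof (induction "card I" arbitrary: I)
  case 0
  then show ?case by (simp add: nsym_diag_empty)
next
  case (Suc k)
  let ?Z = "\<lambda>_::nat. 0::'k"
  have piv: "card (nsym_diag I d) = num_sym q k" if "d \<in> fsupp I - {?Z}" for d
  proof -
    have "d \<noteq> ?Z" using that by simp
    then obtain j where j: "d j \<noteq> 0" by (auto simp: fun_eq_iff)
    then have jI: "j \<in> I" using that by (auto simp: fsupp_def)
    define I' where "I' = I - {j}"
    have I': "I = insert j I'" "j \<notin> I'" "finite I'" "k = card I'"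
      using jI Suc.prems Suc.hyps(2) by (auto simp: I'_def)
    show ?thesis
      using card_nsym_diag_pivot[of I' j d] I' j Suc.hyps(1)[of I'] by simp
  qed
  have "nsym I = (\<Union>d\<in>fsupp I. nsym_diag I d)"
  proof
    show "nsym I \<subseteq> (\<Union>d\<in>fsupp I. nsym_diag I d)"
    proof
      fix S assume S: "S \<in> nsym I"
      then have "S \<in> nsym_diag I (\<lambda>i. S i i)" "(\<lambda>i. S i i) \<in> fsupp I"
        by (auto simp: nsym_diag_def nsym_def fsupp_def)
      then show "S \<in> (\<Union>d\<in>fsupp I. nsym_diag I d)" by blast
    qed
  qed (auto simp: nsym_diag_def)
  then have "card (nsym I) = card (\<Union>d\<in>fsupp I. nsym_diag I d)" by simp
  also have "\<dots> = (\<Sum>d\<in>fsupp I. card (nsym_diag I d))"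
  proof (rule card_UN_disjoint)
    show "\<forall>d\<in>fsupp I. \<forall>d'\<in>fsupp I. d \<noteq> d' \<longrightarrow> nsym_diag I d \<inter> nsym_diag I d' = {}"
      unfolding nsym_diag_def fsupp_def by (auto simp: fun_eq_iff, metis)
  qed (use Suc card_fsupp finite_nsym_diag in auto)
  also have "\<dots> = card (nsym_diag I ?Z) + (\<Sum>d\<in>fsupp I - {?Z}. card (nsym_diag I d))"
    by (rule sum.remove) (use card_fsupp Suc.prems in \<open>auto simp: fsupp_def\<close>)
  also have "\<dots> = num_alt q (Suc k) + card (fsupp I - {?Z}) * num_sym q k"
    using piv Suc.hyps(2) Suc.prems by (simp add: card_nsym_diag_zero)
  also have "card (fsupp I - {?Z}) = q ^ Suc k - 1"
    using card_fsupp[OF Suc.prems] Suc.hyps(2) by (subst card_Diff_singleton) (auto simp: fsupp_def)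
  finally show ?case by (simp flip: Suc.hyps(2))
qed

lemma card_nsym_diag:
  assumes "finite I" "i \<in> I" "d i \<noteq> 0"
  shows "card (nsym_diag I d) = num_sym q (card I - 1)"
proof -
  have "card (nsym_diag (insert i (I - {i})) d) = card (nsym (I - {i}))"
    by (rule card_nsym_diag_pivot) (use assms in auto)
  then show ?thesis using assms by (simp add: insert_absorb card_nsym)
qed

end

section \<open>Isotropic frames and shifts\<close>

text \<open>Padding by zero from \<open>k\<close> on makes sequences of length \<open>k\<close>
  plain functions. \<open>C j A\<close> is the set of admissible entries at position
  \<open>j\<close>; that it looks only at the entries of \<open>A\<close> before \<open>j\<close> is
  imposed by \<open>tuple_choice\<close>.\<close>

definition tuples :: "(nat \<Rightarrow> (nat \<Rightarrow> 'v::zero) \<Rightarrow> 'v set) \<Rightarrow> nat \<Rightarrow> (nat \<Rightarrow> 'v) set" where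
  "tuples C k = {A. (\<forall>i\<ge>k. A i = 0) \<and> (\<forall>j<k. A j \<in> C j A)}"

locale tuple_choice =
  fixes C :: "nat \<Rightarrow> (nat \<Rightarrow> 'v::zero) \<Rightarrow> 'v set"
  assumes C_cong: "\<And>j A A'. (\<And>i. i < j \<Longrightarrow> A i = A' i) \<Longrightarrow> C j A = C j A'"
    and finite_C: "\<And>j A. A \<in> tuples C j \<Longrightarrow> finite (C j A)"
begin

lemma bij_betw_tuples_Suc:
  "bij_betw (\<lambda>(A, v). A(k := v)) (SIGMA A:tuples C k. C k A) (tuples C (Suc k))"
proof (rule bij_betw_byWitness[where f' = "\<lambda>A. (A(k := 0), A k)"])
  have cut: "C j (A(k := v)) = C j A" if "j \<le> k" for j A v
    by (rule C_cong) (use that in auto)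
  show "(\<lambda>(A, v). A(k := v)) ` (SIGMA A:tuples C k. C k A) \<subseteq> tuples C (Suc k)"
    by (auto simp: tuples_def cut less_Suc_eq)
  show "(\<lambda>A. (A(k := 0), A k)) ` tuples C (Suc k) \<subseteq> (SIGMA A:tuples C k. C k A)"
    by (auto simp: tuples_def cut less_Suc_eq)
qed (auto simp: tuples_def fun_eq_iff)

lemma finite_tuples: "finite (tuples C k)"
proof (induction k)
  case 0
  then show ?case by (auto simp: tuples_def fun_eq_iff intro: finite_subset[of _ "{\<lambda>_. 0}"])
next
  case (Suc k)
  then have "finite (SIGMA A:tuples C k. C k A)" by (intro finite_SigmaI finite_C)
  then show ?case using bij_betw_finite[OF bij_betw_tuples_Suc] by blast
qed

lemma card_tuples_0: "card (tuples C 0) = 1"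
proof -
  have "tuples C 0 = {\<lambda>_. 0}" by (auto simp: tuples_def fun_eq_iff)
  then show ?thesis by simp
qed

lemma card_tuples_Suc: "card (tuples C (Suc k)) = (\<Sum>A\<in>tuples C k. card (C k A))"
  using bij_betw_same_card[OF bij_betw_tuples_Suc[of k]] finite_tuples finite_C
  by (simp add: card_SigmaI)

lemma card_tuples:
  assumes "\<And>j A. j < k \<Longrightarrow> A \<in> tuples C j \<Longrightarrow> card (C j A) = c j"
  shows "card (tuples C k) = (\<Prod>j<k. c j)"
  using assms by (induction k) (simp_all add: card_tuples_0 card_tuples_Suc mult.commute)

text \<open>For choices whose number varies with the prefix, as it does for singular
  vectors.\<close>

lemma card_tuples_le:
  fixes c :: "nat \<Rightarrow> real"
  assumes "\<And>j A. j < k \<Longrightarrow> A \<in> tuples C j \<Longrightarrow> card (C j A) \<le> c j" "\<And>j. 0 \<le> c j"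
  shows "card (tuples C k) \<le> (\<Prod>j<k. c j)"
  using assms
proof (induction k)
  case 0
  then show ?case by (simp add: card_tuples_0)
next
  case (Suc k)
  have "real (card (tuples C (Suc k))) = (\<Sum>A\<in>tuples C k. real (card (C k A)))"
    by (simp add: card_tuples_Suc)
  also have "\<dots> \<le> (\<Sum>A\<in>tuples C k. c k)" by (rule sum_mono) (use Suc.prems in auto)
  also have "\<dots> = real (card (tuples C k)) * c k" by simp
  also have "\<dots> \<le> (\<Prod>j<k. c j) * c k"
    using Suc by (intro mult_right_mono) auto
  finally show ?case by simp
qed

end

section \<open>Linear algebra over a finite field by counting\<close>

locale finite_field_space = char_two_field K q + vector_space scale
  for K :: "'k::{field,finite} itself" and q :: nat
    and scale :: "'k \<Rightarrow> 'v::ab_group_add \<Rightarrow> 'v" (infixr "*\<^sub>k" 75)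
begin

lemma vadd_self [simp]: "(v::'v) + v = 0"
proof -
  have "v + v = (1 + 1) *\<^sub>k v" by (simp only: scale_left_distrib scale_one)
  then show ?thesis by simp
qed

lemma card_span_insert:
  assumes "finite (span S)" "a \<notin> span S"
  shows "finite (span (insert a S))" "card (span (insert a S)) = q * card (span S)"
proof -
  have "bij_betw (\<lambda>(c, y). c *\<^sub>k a + y) (UNIV \<times> span S) (span (insert a S))"
  proof (rule bij_betw_imageI)
    show "inj_on (\<lambda>(c, y). c *\<^sub>k a + y) (UNIV \<times> span S)"
    proof (rule inj_onI, clarify)
      fix c c' y y' assume y: "y \<in> span S" "y' \<in> span S" and e: "c *\<^sub>k a + y = c' *\<^sub>k a + y'"
      have "(c - c') *\<^sub>k a = y' - y" using e by (simp add: scale_left_diff_distrib algebra_simps)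
      then have "(c - c') *\<^sub>k a \<in> span S" using y by (simp add: span_diff)
      then have "c = c'"
        using assms(2) span_scale[of "(c - c') *\<^sub>k a" S "inverse (c - c')"]
        by (cases "c = c'") auto
      then show "c = c' \<and> y = y'" using e by simp
    qed
    show "(\<lambda>(c, y). c *\<^sub>k a + y) ` (UNIV \<times> span S) = span (insert a S)"
    proof
      show "(\<lambda>(c, y). c *\<^sub>k a + y) ` (UNIV \<times> span S) \<subseteq> span (insert a S)"
      proof clarsimp
        fix c y assume "y \<in> span S"
        then have "c *\<^sub>k a + y - c *\<^sub>k a \<in> span S" by simp
        then show "c *\<^sub>k a + y \<in> span (insert a S)" unfolding span_insert by blast
      qed
      show "span (insert a S) \<subseteq> (\<lambda>(c, y). c *\<^sub>k a + y) ` (UNIV \<times> span S)"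
      proof
        fix x assume "x \<in> span (insert a S)"
        then obtain c where "x - c *\<^sub>k a \<in> span S" by (auto simp: span_insert)
        then have "(c, x - c *\<^sub>k a) \<in> UNIV \<times> span S" by simp
        moreover have "x = (\<lambda>(c, y). c *\<^sub>k a + y) (c, x - c *\<^sub>k a)" by simp
        ultimately show "x \<in> (\<lambda>(c, y). c *\<^sub>k a + y) ` (UNIV \<times> span S)" by (rule rev_image_eqI)
      qed
    qed
  qed
  note b = this
  show "finite (span (insert a S))" using bij_betw_finite[OF b] assms by simp
  show "card (span (insert a S)) = q * card (span S)"
    using bij_betw_same_card[OF b] by (simp add: card_cartesian_product card_K)
qed

lemma card_span_independent: "finite S \<Longrightarrow> independent S \<Longrightarrow> finite (span S) \<and> card (span S) = q ^ card S"
proof (induction S rule: finite_induct)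
  case empty
  then show ?case by simp
next
  case (insert a S)
  then show ?case using card_span_insert[of S a] by (simp add: independent_insert)
qed

lemma card_subspace:
  assumes "subspace W" "finite W"
  obtains k where "card W = q ^ k"
proof -
  obtain S where "S \<subseteq> W" "independent S" "W \<subseteq> span S"
    using maximal_independent_subset by blast
  moreover have "span S = W" using calculation assms span_minimal by blast
  ultimately show ?thesis
    using that card_span_independent[of S] finite_subset[OF _ assms(2)] by auto
qed

definition comb :: "nat \<Rightarrow> (nat \<Rightarrow> 'v) \<Rightarrow> (nat \<Rightarrow> 'k) \<Rightarrow> 'v" where
  "comb k A x = (\<Sum>i<k. x i *\<^sub>k A i)"

definition indep_seq :: "nat \<Rightarrow> (nat \<Rightarrow> 'v) \<Rightarrow> bool" where
  "indep_seq k A \<longleftrightarrow> (\<forall>j<k. A j \<notin> span (A ` {..<j}))"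

lemma card_span_indep_seq:
  "indep_seq k A \<Longrightarrow> finite (span (A ` {..<k})) \<and> card (span (A ` {..<k})) = q ^ k"
proof (induction k)
  case 0
  then show ?case by simp
next
  case (Suc k)
  then show ?case using card_span_insert[of "A ` {..<k}" "A k"]
    by (simp add: indep_seq_def lessThan_Suc)
qed

lemma span_eq_comb: "span (A ` {..<k}) = comb k A ` fsupp {..<k}"
proof (induction k)
  case 0
  then show ?case by (auto simp: comb_def fsupp_def)
next
  case (Suc k)
  have cut: "comb k A (x(k := c)) = comb k A x" for x c
    unfolding comb_def by (rule sum.cong) auto
  show ?case
  proof
    show "comb (Suc k) A ` fsupp {..<Suc k} \<subseteq> span (A ` {..<Suc k})"
      unfolding comb_def by (intro image_subsetI span_sum span_scale span_base) auto
    show "span (A ` {..<Suc k}) \<subseteq> comb (Suc k) A ` fsupp {..<Suc k}"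
    proof
      fix v assume "v \<in> span (A ` {..<Suc k})"
      then obtain c where "v - c *\<^sub>k A k \<in> span (A ` {..<k})"
        by (auto simp: lessThan_Suc span_insert)
      then obtain x where x: "x \<in> fsupp {..<k}" "v - c *\<^sub>k A k = comb k A x"
        using Suc by auto
      then have "v = comb k A x + c *\<^sub>k A k" by (simp add: algebra_simps)
      then have "v = comb (Suc k) A (x(k := c))"
        using cut[of x c] by (simp add: comb_def)
      moreover have "x(k := c) \<in> fsupp {..<Suc k}" using x by (auto simp: fsupp_def)
      ultimately show "v \<in> comb (Suc k) A ` fsupp {..<Suc k}" by blast
    qed
  qed
qed

text \<open>The \<open>q ^ k\<close> coordinate functions are mapped onto a span that has
  \<open>q ^ k\<close> elements.\<close>

lemma inj_on_comb: assumes "indep_seq k A" shows "inj_on (comb k A) (fsupp {..<k})"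
  by (rule eq_card_imp_inj_on)
     (use card_span_indep_seq[OF assms] card_fsupp[of "{..<k}"] in \<open>simp_all flip: span_eq_comb\<close>)

text \<open>\<open>W\<close> is the direct sum of the line through \<open>w0\<close> and the kernel
  of \<open>f\<close>; adding \<open>(f w / f w0) *\<^sub>k w0\<close> to \<open>w\<close> projects
  onto the kernel because addition is subtraction.\<close>

lemma card_kernel:
  assumes W: "subspace W" "finite W" and w0: "w0 \<in> W" "f w0 \<noteq> 0"
    and add: "\<And>v w. v \<in> W \<Longrightarrow> w \<in> W \<Longrightarrow> f (v + w) = f v + f w"
    and scl: "\<And>c v. v \<in> W \<Longrightarrow> f (c *\<^sub>k v) = c * f v"
  shows "q * card {w \<in> W. f w = (0::'k)} = card W"
proof -
  have "bij_betw (\<lambda>(c, w). c *\<^sub>k w0 + w) (UNIV \<times> {w \<in> W. f w = 0}) W"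
  proof (rule bij_betw_byWitness[where f' = "\<lambda>w. (f w / f w0, w + (f w / f w0) *\<^sub>k w0)"])
    show "(\<lambda>(c, w). c *\<^sub>k w0 + w) ` (UNIV \<times> {w \<in> W. f w = 0}) \<subseteq> W"
      using W w0 by (auto intro: subspace_add subspace_scale)
    show "(\<lambda>w. (f w / f w0, w + (f w / f w0) *\<^sub>k w0)) ` W \<subseteq> UNIV \<times> {w \<in> W. f w = 0}"
      using W w0 by (auto intro!: subspace_add simp: add scl subspace_scale)
    have *: "c *\<^sub>k w0 + (c *\<^sub>k w0 + w) = w" for c w
      by (simp flip: add.assoc)
    show "\<forall>a\<in>UNIV \<times> {w \<in> W. f w = 0}.
       (f (case a of (c, w) \<Rightarrow> c *\<^sub>k w0 + w) / f w0,
        (case a of (c, w) \<Rightarrow> c *\<^sub>k w0 + w) + (f (case a of (c, w) \<Rightarrow> c *\<^sub>k w0 + w) / f w0) *\<^sub>k w0) = a"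
      using W w0 * by (auto simp: add scl subspace_scale add_ac)
    show "\<forall>a'\<in>W. (case (f a' / f w0, a' + (f a' / f w0) *\<^sub>k w0) of (c, w) \<Rightarrow> c *\<^sub>k w0 + w) = a'"
      using * by (auto simp: add_ac)
  qed
  from bij_betw_same_card[OF this] show ?thesis
    by (simp add: card_cartesian_product card_K)
qed

lemma card_bases:
  assumes "finite W" "card W = q ^ k" "subspace W"
  shows "card (tuples (\<lambda>j A. W - span (A ` {..<j})) k) = (\<Prod>i<k. q ^ k - q ^ i)"
proof -
  interpret tuple_choice "\<lambda>j A. W - span (A ` {..<j})"
  proof
    fix j and A A' :: "nat \<Rightarrow> 'v" assume "\<And>i. i < j \<Longrightarrow> A i = A' i"
    then have "A ` {..<j} = A' ` {..<j}" by (intro image_cong) auto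
    then show "W - span (A ` {..<j}) = W - span (A' ` {..<j})" by simp
  qed (use assms in auto)
  show ?thesis
  proof (rule card_tuples)
    fix j A assume "j < k" and A: "A \<in> tuples (\<lambda>j A. W - span (A ` {..<j})) j"
    then have "indep_seq j A" "A ` {..<j} \<subseteq> W" by (auto simp: indep_seq_def tuples_def)
    then have "span (A ` {..<j}) \<subseteq> W" "card (span (A ` {..<j})) = q ^ j" "finite (span (A ` {..<j}))"
      using card_span_indep_seq span_minimal assms(3) by blast+
    then show "card (W - span (A ` {..<j})) = q ^ k - q ^ j"
      using assms by (simp add: card_Diff_subset)
  qed
qed

end

section \<open>Quadratic spaces and orthogonal complements\<close>

text \<open>The space is a carrier set \<open>V\<close> inside a type, so that one type can house
  the spaces of all dimensions \<open>2 * n\<close>. Symmetry of \<open>B\<close> and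
  \<open>B v v = 0\<close> follow from \<open>nu_add\<close> and characteristic 2.\<close>

locale quadratic_space = finite_field_space K q scale
  for K :: "'k::{field,finite} itself" and q :: nat
    and scale :: "'k \<Rightarrow> 'v::ab_group_add \<Rightarrow> 'v" (infixr "*\<^sub>k" 75) +
  fixes V :: "'v set" and n :: nat and nu :: "'v \<Rightarrow> 'k" and B :: "'v \<Rightarrow> 'v \<Rightarrow> 'k"
  assumes subspace_V: "subspace V" and card_V: "card V = q ^ (2 * n)"
    and nu_scale: "\<And>a v. v \<in> V \<Longrightarrow> nu (a *\<^sub>k v) = a\<^sup>2 * nu v"
    and nu_add: "\<And>v w. v \<in> V \<Longrightarrow> w \<in> V \<Longrightarrow> nu (v + w) = nu v + nu w + B v w"
    and B_add: "\<And>u v w. u \<in> V \<Longrightarrow> v \<in> V \<Longrightarrow> w \<in> V \<Longrightarrow> B (u + v) w = B u w + B v w"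
    and B_scale: "\<And>a v w. v \<in> V \<Longrightarrow> w \<in> V \<Longrightarrow> B (a *\<^sub>k v) w = a * B v w"
    and B_nondeg: "\<And>v. v \<in> V \<Longrightarrow> (\<And>w. w \<in> V \<Longrightarrow> B v w = 0) \<Longrightarrow> v = 0"
begin

lemma finite_V: "finite V"
  using card_V q_ge_2 by (intro card_ge_0_finite) simp

lemma V_add: "v \<in> V \<Longrightarrow> w \<in> V \<Longrightarrow> v + w \<in> V"
  and V_scale: "v \<in> V \<Longrightarrow> a *\<^sub>k v \<in> V" and V_0: "0 \<in> V"
  using subspace_V by (simp_all add: subspace_add subspace_scale subspace_0)

lemma B_eq: "v \<in> V \<Longrightarrow> w \<in> V \<Longrightarrow> B v w = nu (v + w) + nu v + nu w"
  using nu_add[of v w] by (simp add: add_ac)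

lemma B_sym: "v \<in> V \<Longrightarrow> w \<in> V \<Longrightarrow> B v w = B w v"
  by (simp add: B_eq add_ac)

lemma nu_0: "nu 0 = 0"
  using nu_scale[OF V_0, of 0] by simp

lemma B_alt: "v \<in> V \<Longrightarrow> B v v = 0"
  by (simp add: B_eq nu_0)

lemma B_add_right: "u \<in> V \<Longrightarrow> v \<in> V \<Longrightarrow> w \<in> V \<Longrightarrow> B w (u + v) = B w u + B w v"
  by (simp add: B_sym[of w] B_add V_add)

lemma B_scale_right: "v \<in> V \<Longrightarrow> w \<in> V \<Longrightarrow> B w (a *\<^sub>k v) = a * B w v"
  by (simp add: B_sym[of w] B_scale V_scale)

lemma B_0 [simp]: "v \<in> V \<Longrightarrow> B v 0 = 0" "v \<in> V \<Longrightarrow> B 0 v = 0"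
  using B_scale[of v v 0] B_scale_right[of v v 0] by auto

lemma comb_in_V: "(\<And>i. i < k \<Longrightarrow> A i \<in> V) \<Longrightarrow> comb k A x \<in> V"
  unfolding comb_def using subspace_V by (intro subspace_sum subspace_scale) auto

lemma comb_0: "comb 0 A x = 0" and comb_Suc: "comb (Suc k) A x = comb k A x + x k *\<^sub>k A k"
  by (simp_all add: comb_def)

lemma B_comb:
  assumes "\<And>i. i < k \<Longrightarrow> A i \<in> V" "v \<in> V"
  shows "B v (comb k A x) = (\<Sum>i<k. x i * B v (A i))"
  using assms
  by (induction k) (simp_all add: comb_0 comb_Suc B_add_right B_scale_right comb_in_V V_scale)

text \<open>The cross terms are values of \<open>B\<close> and vanish. So on an isotropic span
  \<open>nu\<close> is determined by its values on a basis, which become the diagonal of the Gram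
  matrix.\<close>

lemma nu_comb:
  assumes "\<And>i. i < k \<Longrightarrow> A i \<in> V" "\<And>i j. i < k \<Longrightarrow> j < k \<Longrightarrow> B (A i) (A j) = 0"
  shows "nu (comb k A x) = (\<Sum>i<k. (x i)\<^sup>2 * nu (A i))"
  using assms
proof (induction k)
  case 0
  then show ?case by (simp add: comb_0 nu_0)
next
  case (Suc k)
  have "B (x k *\<^sub>k A k) (comb k A x) = 0"
    using Suc by (simp add: B_comb V_scale B_scale)
  then have "B (comb k A x) (x k *\<^sub>k A k) = 0"
    using Suc by (simp add: B_sym[of "comb k A x"] V_scale comb_in_V)
  then show ?case using Suc by (simp add: comb_Suc nu_add comb_in_V V_scale nu_scale)
qed

definition perp :: "'v set \<Rightarrow> 'v set" where
  "perp W = {v \<in> V. \<forall>w\<in>W. B v w = 0}"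

lemma subspace_perp: assumes "W \<subseteq> V" shows "subspace (perp W)"
proof (rule subspaceI)
  show "0 \<in> perp W" using assms by (auto simp: perp_def V_0)
  show "x + y \<in> perp W" if "x \<in> perp W" "y \<in> perp W" for x y
    using that assms by (auto simp: perp_def V_add B_add subset_iff)
  show "c *\<^sub>k x \<in> perp W" if "x \<in> perp W" for x c
    using that assms by (auto simp: perp_def V_scale B_scale subset_iff)
qed

lemma finite_perp: "finite (perp W)"
  using finite_V by (simp add: perp_def)

text \<open>Double counting of the orthogonal pairs in \<open>V \<times> W\<close>: a vector outside the radical is
  orthogonal to exactly one \<open>q\<close>-th of the other space.\<close>

lemma card_perp:
  assumes W: "subspace W" "W \<subseteq> V"
  shows "card (perp W) * card W = card V"
proof -
  have fW: "finite W" using W finite_V finite_subset by blast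
  have W0: "0 \<in> W" using W subspace_0 by blast
  have 1: "q * card {w \<in> W. B v w = 0} = (if v \<in> perp W then q * card W else card W)"
    if v: "v \<in> V" for v
  proof (cases "v \<in> perp W")
    case True
    then have "{w \<in> W. B v w = 0} = W" by (auto simp: perp_def)
    then show ?thesis using True by simp
  next
    case False
    then obtain w0 where "w0 \<in> W" "B v w0 \<noteq> 0" using v by (auto simp: perp_def)
    then have "q * card {w \<in> W. B v w = 0} = card W"
      using W v fW by (intro card_kernel) (auto simp: B_add_right B_scale_right subset_iff)
    then show ?thesis using False by simp
  qed
  have 2: "q * card {v \<in> V. B v w = 0} = (if w = 0 then q * card V else card V)"
    if w: "w \<in> W" for w
  proof (cases "w = 0")
    case False
    have "w \<in> V" using w W by auto
    then obtain v0 where "v0 \<in> V" "B v0 w \<noteq> 0" using B_nondeg[of w] False B_sym by metis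
    then have "q * card {v \<in> V. B v w = 0} = card V"
      using subspace_V \<open>w \<in> V\<close> finite_V by (intro card_kernel) (auto simp: B_add B_scale)
    then show ?thesis using False by simp
  qed (auto simp: Collect_conj_eq Int_absorb2 subset_iff)
  have qx: "q * x = x + (q - 1) * x" for x :: nat using q_ge_2 by (cases q) auto
  have "(\<Sum>v\<in>V. card {w \<in> W. B v w = 0}) = (\<Sum>w\<in>W. card {v \<in> V. B v w = 0})"
    by (rule sum_multicount_gen) (use fW finite_V in auto)
  then have "(\<Sum>v\<in>V. q * card {w \<in> W. B v w = 0}) = (\<Sum>w\<in>W. q * card {v \<in> V. B v w = 0})"
    by (simp flip: sum_distrib_left)
  also have "(\<Sum>v\<in>V. q * card {w \<in> W. B v w = 0})
      = (\<Sum>v\<in>V. card W + (if v \<in> perp W then (q - 1) * card W else 0))"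
    by (intro sum.cong refl) (use 1 qx[of "card W"] in auto)
  also have "\<dots> = card V * card W + card (perp W) * ((q - 1) * card W)"
    using finite_V by (simp add: sum.distrib sum.If_cases perp_def Int_def)
  also have "(\<Sum>w\<in>W. q * card {v \<in> V. B v w = 0})
      = (\<Sum>w\<in>W. card V + (if w = 0 then (q - 1) * card V else 0))"
    by (intro sum.cong refl) (use 2 qx[of "card V"] in auto)
  also have "\<dots> = card W * card V + (q - 1) * card V"
    using fW W0 by (simp add: sum.distrib)
  finally have "(q - 1) * (card (perp W) * card W) = (q - 1) * card V"
    by (simp add: algebra_simps)
  then show ?thesis using q_ge_2 by simp
qed

text \<open>Since \<open>B a a = 0\<close> always holds, a vector orthogonal to the span can be
  adjoined whatever the value \<open>nu a\<close> is.\<close>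

lemma isotropic_span_insert:
  assumes "span S \<subseteq> perp (span S)" and "a \<in> perp (span S)"
  shows "span (insert a S) \<subseteq> perp (span (insert a S))"
proof
  have inV: "span S \<subseteq> V" "a \<in> V" using assms by (auto simp: perp_def)
  have orth: "B a y = 0" "B y a = 0" if "y \<in> span S" for y
    using that assms inV by (auto simp: perp_def B_sym[of y])
  have form: "\<exists>c y. x = c *\<^sub>k a + y \<and> y \<in> span S" if "x \<in> span (insert a S)" for x
  proof -
    have "\<exists>c. x - c *\<^sub>k a \<in> span S" using that by (simp add: span_insert)
    then obtain c where "x - c *\<^sub>k a \<in> span S" by blast
    then show ?thesis by (intro exI[of _ c] exI[of _ "x - c *\<^sub>k a"]) simp
  qed
  fix x assume "x \<in> span (insert a S)"
  then obtain c y where x: "x = c *\<^sub>k a + y" "y \<in> span S" using form by blast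
  have "B x x' = 0" if "x' \<in> span (insert a S)" for x'
  proof -
    from form[OF that] obtain c' y' where x': "x' = c' *\<^sub>k a + y'" "y' \<in> span S" by blast
    have "B y y' = 0" using x x' assms by (auto simp: perp_def)
    then show ?thesis using x x' inV orth B_alt
      by (simp add: B_add B_add_right B_scale B_scale_right V_scale V_add subset_iff)
  qed
  then show "x \<in> perp (span (insert a S))"
    using x inV by (auto simp: perp_def V_add V_scale subset_iff)
qed

section \<open>Frames and their numbers\<close>

text \<open>Ordered bases of subspaces that are totally isotropic for \<open>B\<close>;
  \<open>nu\<close> is left free.\<close>

definition frames :: "nat \<Rightarrow> (nat \<Rightarrow> 'v) set" where
  "frames = tuples (\<lambda>j A. perp (span (A ` {..<j})) - span (A ` {..<j}))"

text \<open>By \<open>nu_comb\<close> these are the frames on whose whole span \<open>nu\<close>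
  vanishes, that is, the bases of totally singular subspaces.\<close>

definition sing_frames :: "nat \<Rightarrow> (nat \<Rightarrow> 'v) set" where
  "sing_frames = tuples (\<lambda>j A. {v \<in> perp (span (A ` {..<j})) - span (A ` {..<j}). nu v = 0})"

lemma frames_indep_seq: "A \<in> frames k \<Longrightarrow> indep_seq k A"
  by (auto simp: frames_def tuples_def indep_seq_def)

lemma frames_isotropic: "A \<in> frames k \<Longrightarrow> span (A ` {..<k}) \<subseteq> perp (span (A ` {..<k}))"
proof -
  assume A: "A \<in> frames k"
  have "j \<le> k \<Longrightarrow> span (A ` {..<j}) \<subseteq> perp (span (A ` {..<j}))" for j
  proof (induction j)
    case 0
    then show ?case using V_0 by (auto simp: perp_def)
  next
    case (Suc j)
    then have "A j \<in> perp (span (A ` {..<j}))" using A by (auto simp: frames_def tuples_def)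
    then show ?case using isotropic_span_insert[of "A ` {..<j}" "A j"] Suc
      by (simp add: lessThan_Suc)
  qed
  then show ?thesis by simp
qed

lemma frames_in_V: "A \<in> frames k \<Longrightarrow> i < k \<Longrightarrow> A i \<in> V"
  by (auto simp: frames_def tuples_def perp_def)

lemma frames_orth: "A \<in> frames k \<Longrightarrow> i < k \<Longrightarrow> j < k \<Longrightarrow> B (A i) (A j) = 0"
  using frames_isotropic[of A k] span_base[of "A i" "A ` {..<k}"] span_base[of "A j" "A ` {..<k}"]
  by (auto simp: perp_def)

lemma card_perp_frame:
  assumes "A \<in> frames k" "k \<le> 2 * n"
  shows "card (perp (span (A ` {..<k}))) = q ^ (2 * n - k)"
proof -
  have "span (A ` {..<k}) \<subseteq> V" using frames_isotropic[OF assms(1)] by (auto simp: perp_def)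
  from card_perp[OF subspace_span this]
  have "card (perp (span (A ` {..<k}))) * q ^ k = q ^ (2 * n - k) * q ^ k"
    using card_span_indep_seq[OF frames_indep_seq[OF assms(1)]] assms(2)
    by (simp add: card_V flip: power_add)
  then show ?thesis using q_ge_2 by simp
qed

lemma span_image_cong: "(\<And>i. i < j \<Longrightarrow> A i = A' i) \<Longrightarrow> span (A ` {..<j}) = span (A' ` {..<j})"
  by (intro arg_cong[where f = span] image_cong) auto

lemma tuple_choice_frames: "tuple_choice (\<lambda>j A. perp (span (A ` {..<j})) - span (A ` {..<j}))"
proof
  fix j and A A' :: "nat \<Rightarrow> 'v" assume "\<And>i. i < j \<Longrightarrow> A i = A' i"
  then have "span (A ` {..<j}) = span (A' ` {..<j})" by (rule span_image_cong)
  then   show "perp (span (A ` {..<j})) - span (A ` {..<j}) = perp (span (A' ` {..<j})) - span (A' ` {..<j})"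
    by simp
qed (use finite_perp in auto)

lemma tuple_choice_sing_frames:
  "tuple_choice (\<lambda>j A. {v \<in> perp (span (A ` {..<j})) - span (A ` {..<j}). nu v = 0})"
proof
  fix j and A A' :: "nat \<Rightarrow> 'v" assume "\<And>i. i < j \<Longrightarrow> A i = A' i"
  then have "span (A ` {..<j}) = span (A' ` {..<j})" by (rule span_image_cong)
  then   show "{v \<in> perp (span (A ` {..<j})) - span (A ` {..<j}). nu v = 0}
      = {v \<in> perp (span (A' ` {..<j})) - span (A' ` {..<j}). nu v = 0}"
    by simp
qed (use finite_perp in auto)

lemma finite_frames: "finite (frames k)"
  unfolding frames_def by (rule tuple_choice.finite_tuples[OF tuple_choice_frames])

lemma card_frames:
  assumes "k \<le> n"
  shows "card (frames k) = (\<Prod>i<k. q ^ (2 * n - i) - q ^ i)"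
  unfolding frames_def
proof (rule tuple_choice.card_tuples[OF tuple_choice_frames])
  fix j A assume "j < k" and "A \<in> tuples (\<lambda>j A. perp (span (A ` {..<j})) - span (A ` {..<j})) j"
  then have A: "A \<in> frames j" "j \<le> 2 * n" using assms by (auto simp: frames_def)
  then show "card (perp (span (A ` {..<j})) - span (A ` {..<j})) = q ^ (2 * n - j) - q ^ j"
    using card_perp_frame[OF A] frames_isotropic[OF A(1)]
      card_span_indep_seq[OF frames_indep_seq[OF A(1)]]
    by (simp add: card_Diff_subset)
qed

lemma sing_frames_eq: "sing_frames k = {A \<in> frames k. \<forall>i<k. nu (A i) = 0}"
  by (auto simp: frames_def sing_frames_def tuples_def)

text \<open>If \<open>B w0 w1 \<noteq> 0\<close>, the values of \<open>\<nu>\<close> on a coset of \<open>{0, w0, w1, w0 + w1}\<close> add up to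
  \<open>B w0 w1\<close>, so \<open>\<nu>\<close> does not vanish on a whole coset.\<close>

lemma card_singular_le:
  assumes P: "P \<subseteq> V" "subspace P" and w: "w0 \<in> P" "w1 \<in> P" "B w0 w1 \<noteq> 0"
  shows "4 * card {v \<in> P. nu v = 0} \<le> 3 * card P"
proof -
  define N where "N = {v \<in> P. nu v \<noteq> 0}"
  have fP: "finite P" using P finite_V finite_subset by blast
  have PV: "v \<in> P \<Longrightarrow> v \<in> V" for v using P by auto
  have "P \<subseteq> (\<Union>t\<in>{0, w0, w1, w0 + w1}. (\<lambda>v. v + t) ` N)"
  proof
    fix v assume v: "v \<in> P"
    have "nu (v + 0) + (nu (v + w0) + (nu (v + w1) + nu (v + (w0 + w1)))) = B w0 w1"
      using PV[OF v] PV[OF w(1)] PV[OF w(2)]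
      by (simp add: nu_add V_add B_add_right add_ac)
    then have "nu (v + 0) \<noteq> 0 \<or> nu (v + w0) \<noteq> 0 \<or> nu (v + w1) \<noteq> 0 \<or> nu (v + (w0 + w1)) \<noteq> 0"
      using w(3) by auto
    then obtain t where t: "t \<in> {0, w0, w1, w0 + w1}" "nu (v + t) \<noteq> 0" by blast
    have "t \<in> P" using t w P by (auto intro: subspace_add subspace_0)
    then have "v + t \<in> N" using t v P by (auto simp: N_def intro: subspace_add)
    moreover have "v = (v + t) + t" by (simp add: add.assoc)
    ultimately show "v \<in> (\<Union>t\<in>{0, w0, w1, w0 + w1}. (\<lambda>v. v + t) ` N)" using t by blast
  qed
  then have "card P \<le> card (\<Union>t\<in>{0, w0, w1, w0 + w1}. (\<lambda>v. v + t) ` N)"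
    using fP by (intro card_mono) (auto simp: N_def)
  also have "\<dots> \<le> (\<Sum>t\<in>{0, w0, w1, w0 + w1}. card ((\<lambda>v. v + t) ` N))"
    by (rule card_UN_le) simp
  also have "\<dots> \<le> (\<Sum>t\<in>{0, w0, w1, w0 + w1}. card N)"
    by (rule sum_mono) (use fP in \<open>auto simp: N_def intro: card_image_le\<close>)
  also have "\<dots> = card {0, w0, w1, w0 + w1} * card N" by simp
  also have "\<dots> \<le> 4 * card N"
    by (intro mult_right_mono) (simp_all add: card_insert_if)
  finally have "card P \<le> 4 * card N" .
  moreover have "card P = card {v \<in> P. nu v = 0} + card N"
    using fP by (subst card_Un_disjoint[symmetric]) (auto simp: N_def intro!: arg_cong[where f = card])
  ultimately show ?thesis by simp
qed

text \<open>The candidates for entry \<open>j < n\<close> lie in a space \<open>P\<close> of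
  dimension \<open>2 * n - j > n\<close>, too large to be isotropic. So
  \<open>card_singular_le\<close> applies at every step and gives the factor \<open>3/4\<close>. The
  already chosen span is not subtracted, as only an upper bound is wanted.\<close>

lemma card_sing_frames:
  assumes "k \<le> n"
  shows "real (card (sing_frames k)) \<le> (\<Prod>i<k. 3/4 * real q ^ (2 * n - i))"
  unfolding sing_frames_def
proof (rule tuple_choice.card_tuples_le[OF tuple_choice_sing_frames])
  fix j A
  assume j: "j < k" and
    "A \<in> tuples (\<lambda>j A. {v \<in> perp (span (A ` {..<j})) - span (A ` {..<j}). nu v = 0}) j"
  then have A: "A \<in> frames j" "j \<le> 2 * n"
    using assms sing_frames_eq[of j] by (auto simp: sing_frames_def)
  define P where "P = perp (span (A ` {..<j}))"
  have SV: "span (A ` {..<j}) \<subseteq> V" using frames_isotropic[OF A(1)] by (auto simp: perp_def)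
  have cP: "card P = q ^ (2 * n - j)" using card_perp_frame[OF A] by (simp add: P_def)
  have PV: "P \<subseteq> V" "subspace P" "finite P"
    using subspace_perp[OF SV] finite_perp by (auto simp: P_def) (auto simp: perp_def)
  \<comment> \<open>An isotropic \<open>P\<close> would satisfy
    \<open>card P * card P \<le> card V\<close>.\<close>
  have "\<not> P \<subseteq> perp P"
  proof
    assume "P \<subseteq> perp P"
    then have "card P * card P \<le> card (perp P) * card P"
      by (intro mult_right_mono card_mono finite_perp) auto
    then have "q ^ (2 * n - j + (2 * n - j)) \<le> q ^ (2 * n)"
      using card_perp[OF PV(2,1)] by (simp only: cP card_V power_add)
    then have "2 * n - j + (2 * n - j) \<le> 2 * n"
      using q_ge_2 by (subst (asm) power_increasing_iff) auto
    then show False using j assms by simp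
  qed
  then obtain w0 w1 where "w0 \<in> P" "w1 \<in> P" "B w0 w1 \<noteq> 0"
    using PV by (auto simp: perp_def)
  from card_singular_le[OF PV(1,2) this]
  have "4 * card {v \<in> P. nu v = 0} \<le> 3 * q ^ (2 * n - j)" by (simp add: cP)
  moreover have "card {v \<in> P - span (A ` {..<j}). nu v = 0} \<le> card {v \<in> P. nu v = 0}"
    using PV by (intro card_mono) auto
  ultimately have "4 * card {v \<in> P - span (A ` {..<j}). nu v = 0} \<le> 3 * q ^ (2 * n - j)" by simp
  then have "real (4 * card {v \<in> P - span (A ` {..<j}). nu v = 0}) \<le> real (3 * q ^ (2 * n - j))"
    by (subst of_nat_le_iff)
  then show "real (card {v \<in> perp (span (A ` {..<j})) - span (A ` {..<j}). nu v = 0})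
      \<le> 3/4 * real q ^ (2 * n - j)"
    by (simp add: P_def)
qed simp

text \<open>The maps \<open>T = g - 1\<close> for the involutions \<open>g\<close> of the orthogonal group: in characteristic 2 the
  condition \<open>g\<^sup>2 = 1\<close> reads \<open>T\<^sup>2 = 0\<close>, and \<open>g\<close> preserves \<open>\<nu>\<close> iff \<open>\<nu> (T v) = B v (T v)\<close>.\<close>

definition shifts :: "('v \<Rightarrow> 'v) set" where
  "shifts = {T. (\<forall>v. v \<notin> V \<longrightarrow> T v = 0) \<and> (\<forall>v\<in>V. T v \<in> V)
    \<and> (\<forall>v\<in>V. \<forall>w\<in>V. T (v + w) = T v + T w) \<and> (\<forall>a. \<forall>v\<in>V. T (a *\<^sub>k v) = a *\<^sub>k T v)
    \<and> (\<forall>v\<in>V. T (T v) = 0) \<and> (\<forall>v\<in>V. nu (T v) = B v (T v))}"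

lemma shiftsD:
  assumes "T \<in> shifts"
  shows "v \<notin> V \<Longrightarrow> T v = 0" "v \<in> V \<Longrightarrow> T v \<in> V"
    "v \<in> V \<Longrightarrow> w \<in> V \<Longrightarrow> T (v + w) = T v + T w" "v \<in> V \<Longrightarrow> T (a *\<^sub>k v) = a *\<^sub>k T v"
    "v \<in> V \<Longrightarrow> T (T v) = 0" "v \<in> V \<Longrightarrow> nu (T v) = B v (T v)"
  using assms by (auto simp: shifts_def)

lemma finite_shifts: "finite shifts"
proof (rule finite_subset)
  show "finite {T. \<forall>v. (v \<in> V \<longrightarrow> T v \<in> V) \<and> (v \<notin> V \<longrightarrow> T v = 0)}"
    using finite_V by (intro finite_set_of_finite_funs)
qed (auto simp: shifts_def)

text \<open>Polarizing \<open>nu (T v) = B v (T v)\<close> gives the identity \<open>pol\<close>; it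
  is then applied with one argument already in the image of \<open>T\<close>.\<close>

lemma shift_image_isotropic:
  assumes T: "T \<in> shifts" and v: "v \<in> V" "w \<in> V"
  shows "B (T v) (T w) = 0"
proof -
  note t = shiftsD[OF T]
  have pol: "B (T u) (T w) = B u (T w) + B w (T u)" if "u \<in> V" "w \<in> V" for u w
  proof -
    have "nu (T (u + w)) = B (u + w) (T (u + w))" using that by (intro t V_add)
    then have "nu (T u) + (nu (T w) + B (T u) (T w)) = nu (T u) + (nu (T w) + (B u (T w) + B w (T u)))"
      using that t by (simp add: nu_add B_add B_add_right V_add add_ac)
    then show ?thesis by simp
  qed
  \<comment> \<open>Here \<open>T (T w) = 0\<close> removes every term of \<open>pol\<close> except
    this one.\<close>
  have "B (T w) (T v) = 0" using pol[of v "T w"] t v by simp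
  then show ?thesis using B_sym t v by simp
qed

text \<open>This is what makes \<open>b (T v) (T w) = B v (T w)\<close> well defined and symmetric:
  the value depends on \<open>v\<close> only through \<open>T v\<close>.\<close>

lemma shift_self_adjoint:
  assumes T: "T \<in> shifts" and v: "v \<in> V" "w \<in> V"
  shows "B v (T w) = B w (T v)"
proof -
  note t = shiftsD[OF T]
  have "nu (T (v + w)) = B (v + w) (T (v + w))" using v by (intro t V_add)
  then have "nu (T v) + (nu (T w) + B (T v) (T w)) = nu (T v) + (nu (T w) + (B v (T w) + B w (T v)))"
    using v t by (simp add: nu_add B_add B_add_right V_add add_ac)
  then show ?thesis using shift_image_isotropic[OF assms] by (simp add: add_eq_0_iff_eq)
qed

lemma subspace_shift_image: assumes T: "T \<in> shifts" shows "subspace (T ` V)"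
proof (rule subspaceI)
  note t = shiftsD[OF T]
  have "T (0 *\<^sub>k 0) = 0" using t(4)[OF V_0, of 0] by simp
  then show "0 \<in> T ` V" using V_0 by (metis image_eqI scale_zero_left)
  show "x + y \<in> T ` V" if "x \<in> T ` V" "y \<in> T ` V" for x y
    using that by (auto simp flip: t(3) intro: V_add)
  show "c *\<^sub>k x \<in> T ` V" if "x \<in> T ` V" for x c
    using that by (auto simp flip: t(4) intro: V_scale)
qed

text \<open>The matrix \<open>S\<close> is the Gram matrix, in the basis \<open>A\<close> of the image of \<open>T\<close>, of the form
  \<open>b (T v) (T w) = B v (T w)\<close>.  Hence the coordinates of \<open>T v\<close> solve \<open>S x = (B v (A i))\<^sub>i\<close>.\<close>

definition solves :: "nat \<Rightarrow> (nat \<Rightarrow> 'v) \<Rightarrow> (nat \<Rightarrow> nat \<Rightarrow> 'k) \<Rightarrow> 'v \<Rightarrow> (nat \<Rightarrow> 'k) \<Rightarrow> bool" where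
  "solves k A S v x \<longleftrightarrow> x \<in> fsupp {..<k} \<and> (\<forall>i<k. (\<Sum>j<k. S i j * x j) = B v (A i))"

definition sol :: "nat \<Rightarrow> (nat \<Rightarrow> 'v) \<Rightarrow> (nat \<Rightarrow> nat \<Rightarrow> 'k) \<Rightarrow> 'v \<Rightarrow> nat \<Rightarrow> 'k" where
  "sol k A S v = (THE x. solves k A S v x)"

definition shift_of :: "nat \<Rightarrow> (nat \<Rightarrow> 'v) \<Rightarrow> (nat \<Rightarrow> nat \<Rightarrow> 'k) \<Rightarrow> 'v \<Rightarrow> 'v" where
  "shift_of k A S v = (if v \<in> V then comb k A (sol k A S v) else 0)"

lemma fsupp_add: "x \<in> fsupp I \<Longrightarrow> y \<in> fsupp I \<Longrightarrow> (\<lambda>i. x i + y i) \<in> fsupp I"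
  and fsupp_scale: "x \<in> fsupp I \<Longrightarrow> (\<lambda>i. c * x i) \<in> fsupp I"
  by (auto simp: fsupp_def)

lemma comb_add: "comb k A (\<lambda>i. x i + y i) = comb k A x + comb k A y"
  and comb_scale: "comb k A (\<lambda>i. c * x i) = c *\<^sub>k comb k A x"
  by (simp_all add: comb_def scale_left_distrib sum.distrib scale_sum_right)

text \<open>A trivial kernel gives injectivity, and an injective self-map of a finite set is
  onto.\<close>

lemma bij_nondeg:
  assumes "nondeg {..<k} S"
  shows "bij_betw (\<lambda>x i. if i < k then \<Sum>j<k. S i j * x j else 0) (fsupp {..<k}) (fsupp {..<k})"
proof -
  let ?f = "\<lambda>x i. if i < k then \<Sum>j<k. S i j * x j else 0"
  have inj: "inj_on ?f (fsupp {..<k})"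
  proof (rule inj_onI)
    fix x y assume x: "x \<in> fsupp {..<k}" "y \<in> fsupp {..<k}" "?f x = ?f y"
    have "(\<Sum>j\<in>{..<k}. S i j * (x j + y j)) = 0" if "i \<in> {..<k}" for i
      using fun_cong[OF x(3), of i] that by (simp add: distrib_left sum.distrib)
    then have "x i + y i = 0" if "i < k" for i
      using nondegD[OF assms, of "\<lambda>i. x i + y i" i] that by simp
    then have "x i = y i" if "i < k" for i using that by (simp add: add_eq_0_iff_eq)
    then show "x = y" using x(1,2) by (simp add: fsupp_def fun_eq_iff) (metis lessThan_iff)
  qed
  have "?f ` fsupp {..<k} \<subseteq> fsupp {..<k}" by (auto simp: fsupp_def)
  then have "?f ` fsupp {..<k} = fsupp {..<k}"
    using card_fsupp inj by (intro endo_inj_surj) auto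
  then show ?thesis using inj by (simp add: bij_betw_def)
qed

lemma solves_sol:
  assumes "nondeg {..<k} S"
  shows "solves k A S v (sol k A S v)" and "solves k A S v x \<Longrightarrow> sol k A S v = x"
proof -
  let ?f = "\<lambda>x i. if i < k then \<Sum>j<k. S i j * x j else 0"
  let ?b = "\<lambda>i. if i < k then B v (A i) else 0"
  have eq: "solves k A S v x \<longleftrightarrow> x \<in> fsupp {..<k} \<and> ?f x = ?b" for x
    by (auto simp: solves_def fun_eq_iff)
  have "?b \<in> fsupp {..<k}" by (auto simp: fsupp_def)
  then have ex1: "\<exists>!x. solves k A S v x"
    using bij_nondeg[OF assms] unfolding eq bij_betw_def
    by (smt (verit) image_iff inj_onD)
  show "solves k A S v (sol k A S v)" unfolding sol_def by (rule theI'[OF ex1])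
  show "solves k A S v x \<Longrightarrow> sol k A S v = x" unfolding sol_def by (rule the1_equality[OF ex1])
qed

text \<open>Two vectors with the same products against the frame differ by an element of
  \<open>perp ?W\<close>, so each fibre has at most \<open>card (perp ?W)\<close> elements. If some
  \<open>b\<close> were missed, fewer than \<open>q ^ k\<close> fibres would cover \<open>V\<close>,
  against \<open>card (perp ?W) * q ^ k = card V\<close>.\<close>

lemma ex_dual:
  assumes A: "A \<in> frames k" and b: "b \<in> fsupp {..<k}"
  shows "\<exists>v\<in>V. \<forall>i<k. B v (A i) = b i"
proof -
  let ?W = "span (A ` {..<k})"
  let ?f = "\<lambda>v i. if i < k then B v (A i) else 0"
  note AV = frames_in_V[OF A]
  have cW: "card ?W = q ^ k" using card_span_indep_seq[OF frames_indep_seq[OF A]] by simp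
  have WV: "?W \<subseteq> V" using frames_isotropic[OF A] by (auto simp: perp_def)
  have fib: "card {v \<in> V. ?f v = c} \<le> card (perp ?W)" for c
  proof (cases "{v \<in> V. ?f v = c} = {}")
    case False
    then obtain u where u: "u \<in> V" "?f u = c" by blast
    have "v + u \<in> perp ?W" if v: "v \<in> V" "?f v = c" for v
    proof -
      have e: "B v (A i) = B u (A i)" if "i < k" for i
        using fun_cong[OF v(2)[folded u(2)], of i] that by simp
      have "B (v + u) w = 0" if "w \<in> ?W" for w
      proof -
        obtain x where "w = comb k A x" using \<open>w \<in> ?W\<close> by (auto simp: span_eq_comb)
        then show ?thesis using u v AV e by (simp add: B_comb B_add V_add)
      qed
      then show ?thesis using u v by (auto simp: perp_def V_add)
    qed
    then have "(\<lambda>v. v + u) ` {v \<in> V. ?f v = c} \<subseteq> perp ?W" by auto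
    then have "card ((\<lambda>v. v + u) ` {v \<in> V. ?f v = c}) \<le> card (perp ?W)"
      by (intro card_mono finite_perp)
    then show ?thesis by (simp add: card_image)
  next
    case True
    then show ?thesis by (simp only: card.empty le0)
  qed
  have "b \<in> ?f ` V"
  proof (rule ccontr)
    assume nb: "b \<notin> ?f ` V"
    have "?f ` V \<subset> fsupp {..<k}" using nb b by (auto simp: fsupp_def)
    then have "card (?f ` V) < card (fsupp {..<k})"
      by (intro psubset_card_mono card_fsupp) auto
    then have lt: "card (?f ` V) < q ^ k" by (simp add: card_fsupp)
    have "V = (\<Union>c\<in>?f ` V. {v \<in> V. ?f v = c})" by auto
    then have "card V \<le> (\<Sum>c\<in>?f ` V. card {v \<in> V. ?f v = c})"
      using card_UN_le[of "?f ` V" "\<lambda>c. {v \<in> V. ?f v = c}"] finite_V by simp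
    also have "\<dots> \<le> (\<Sum>c\<in>?f ` V. card (perp ?W))" by (intro sum_mono fib)
    also have "\<dots> = card (?f ` V) * card (perp ?W)" by simp
    finally have "q ^ k * card (perp ?W) \<le> card (?f ` V) * card (perp ?W)"
      using card_perp[OF subspace_span WV] cW by (simp add: mult.commute)
    then have "card (perp ?W) = 0" using lt by simp
    then show False using card_perp[OF subspace_span WV] q_ge_2 by (simp add: card_V)
  qed
  then obtain v where v: "v \<in> V" "b = ?f v" by blast
  show ?thesis by (rule bexI[OF _ v(1)]) (simp add: v(2))
qed

text \<open>Linearity comes from uniqueness of the solution. The image lies in an isotropic span, so
  a second application has right-hand side zero, and the square of the map vanishes. The condition
  on \<open>nu\<close> compares the quadratic form of \<open>S\<close> with its diagonal.\<close>

lemma shift_of_in_shifts: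
  assumes A: "A \<in> frames k" and S: "S \<in> nsym_diag {..<k} (\<lambda>i. nu (A i))"
  shows "shift_of k A S \<in> shifts"
proof -
  have nd: "nondeg {..<k} S" and sym: "S i j = S j i" and diag: "i < k \<Longrightarrow> S i i = nu (A i)" for i j
    using S by (auto simp: nsym_diag_def nsym_def)
  note AV = frames_in_V[OF A]
  note sl = solves_sol(1)[OF nd, of A] and slI = solves_sol(2)[OF nd, of A]
  have combV: "comb k A x \<in> V" for x by (rule comb_in_V) (rule AV)
  let ?T = "shift_of k A S"
  have TV: "?T v \<in> V" for v by (simp add: shift_of_def combV V_0)
  have "?T (v + w) = ?T v + ?T w" if "v \<in> V" "w \<in> V" for v w
  proof -
    have "sol k A S (v + w) = (\<lambda>i. sol k A S v i + sol k A S w i)"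
      by (rule slI) (use sl[of v] sl[of w] AV that in
        \<open>auto simp: solves_def fsupp_add B_add distrib_left sum.distrib\<close>)
    then show ?thesis using that by (simp add: shift_of_def comb_add V_add)
  qed
  moreover have "?T (a *\<^sub>k v) = a *\<^sub>k ?T v" if "v \<in> V" for v a
  proof -
    have "sol k A S (a *\<^sub>k v) = (\<lambda>i. a * sol k A S v i)"
      by (rule slI) (use sl[of v] AV that in
        \<open>auto simp: solves_def fsupp_scale B_scale mult.left_commute simp flip: sum_distrib_left\<close>)
    then show ?thesis using that by (simp add: shift_of_def comb_scale V_scale)
  qed
  moreover have "?T (?T v) = 0" if "v \<in> V" for v
  proof -
    have "B (?T v) (A i) = 0" if "i < k" for i
    proof -
      have "B (A i) (?T v) = 0"
        using \<open>i < k\<close> \<open>v \<in> V\<close> AV frames_orth[OF A] by (simp add: shift_of_def B_comb)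
      then show ?thesis using B_sym AV TV that by simp
    qed
    then have "sol k A S (?T v) = (\<lambda>_. 0)"
      by (intro slI) (auto simp: solves_def fsupp_def)
    then show ?thesis by (simp add: shift_of_def comb_def)
  qed
  moreover have "nu (?T v) = B v (?T v)" if v: "v \<in> V" for v
  proof -
    define x where "x = sol k A S v"
    have Sx: "i < k \<Longrightarrow> B v (A i) = (\<Sum>j<k. S i j * x j)" for i
      using sl[of v] by (simp add: solves_def x_def)
    have "B v (?T v) = (\<Sum>i<k. x i * B v (A i))"
      using v AV by (simp add: shift_of_def B_comb x_def)
    also have "\<dots> = (\<Sum>i<k. \<Sum>j<k. S i j * x i * x j)"
      by (intro sum.cong) (auto simp: Sx sum_distrib_left mult_ac)
    \<comment> \<open>By symmetry of \<open>S\<close> the off-diagonal terms come in equal pairs,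
      which cancel in characteristic 2.\<close>
    also have "\<dots> = (\<Sum>i<k. S i i * x i * x i)"
    proof -
      have "(\<Sum>i<m. \<Sum>j<m. S i j * x i * x j) = (\<Sum>i<m. S i i * x i * x i)" for m
      proof (induction m)
        case (Suc m)
        have "(\<Sum>i<m. S i m * x i * x m) = (\<Sum>j<m. S m j * x m * x j)"
          by (intro sum.cong) (auto simp: sym[of _ m] mult_ac)
        then show ?case by (simp add: sum.distrib Suc add_ac)
      qed simp
      then show ?thesis .
    qed
    also have "\<dots> = (\<Sum>i<k. (x i)\<^sup>2 * nu (A i))"
      by (intro sum.cong) (auto simp: diag power2_eq_square mult_ac)
    also have "\<dots> = nu (?T v)"
      using v AV frames_orth[OF A] by (simp add: shift_of_def nu_comb x_def)
    finally show ?thesis by simp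
  qed
  ultimately show ?thesis using TV by (auto simp: shifts_def) (simp add: shift_of_def)
qed

lemma ex_sol:
  assumes A: "A \<in> frames k" and S: "S \<in> nsym_diag {..<k} d" and x: "x \<in> fsupp {..<k}"
  shows "\<exists>v\<in>V. sol k A S v = x"
proof -
  have nd: "nondeg {..<k} S" using S by (auto simp: nsym_diag_def nsym_def)
  have "(\<lambda>i. if i < k then \<Sum>j<k. S i j * x j else 0) \<in> fsupp {..<k}" by (auto simp: fsupp_def)
  from ex_dual[OF A this] obtain v where "v \<in> V" "\<forall>i<k. B v (A i) = (\<Sum>j<k. S i j * x j)"
    by auto
  then have "solves k A S v x" using x by (simp add: solves_def)
  then show ?thesis using solves_sol(2)[OF nd] \<open>v \<in> V\<close> by blast
qed

lemma shift_of_image: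
  assumes A: "A \<in> frames k" and S: "S \<in> nsym_diag {..<k} d"
  shows "shift_of k A S ` V = span (A ` {..<k})"
proof -
  have nd: "nondeg {..<k} S" using S by (auto simp: nsym_diag_def nsym_def)
  have "shift_of k A S ` V = comb k A ` (sol k A S ` V)"
    by (auto simp: shift_of_def)
  also have "sol k A S ` V = fsupp {..<k}"
    using solves_sol(1)[OF nd] ex_sol[OF A S] by (fastforce simp: solves_def)
  finally show ?thesis by (simp add: span_eq_comb)
qed

text \<open>The map determines \<open>S\<close> column by column: for a \<open>v\<close> that is
  sent to \<open>A j\<close>, the entries are \<open>S i j = B v (A i)\<close>.\<close>

lemma inj_on_shift_of:
  assumes A: "A \<in> frames k"
  shows "inj_on (shift_of k A) (nsym_diag {..<k} d)"
proof (rule inj_onI)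
  fix S S' assume S: "S \<in> nsym_diag {..<k} d" "S' \<in> nsym_diag {..<k} d"
    and e: "shift_of k A S = shift_of k A S'"
  have nd: "nondeg {..<k} S" "nondeg {..<k} S'" using S by (auto simp: nsym_diag_def nsym_def)
  have "S i j = S' i j" for i j
  proof (cases "i < k \<and> j < k")
    case False
    then show ?thesis using S nsym_outside[of S "{..<k}" i j] nsym_outside[of S' "{..<k}" i j]
      by (auto simp: nsym_diag_def)
  next
    case True
    let ?x = "\<lambda>m. if m = j then 1 else 0 :: 'k"
    have x: "?x \<in> fsupp {..<k}" using True by (auto simp: fsupp_def)
    obtain v where v: "v \<in> V" "sol k A S v = ?x" using ex_sol[OF A S(1) x] by blast
    have "comb k A (sol k A S v) = comb k A (sol k A S' v)"
      using fun_cong[OF e, of v] v by (simp add: shift_of_def)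
    then have v': "sol k A S' v = ?x"
      using inj_onD[OF inj_on_comb[OF frames_indep_seq[OF A]]] solves_sol(1)[OF nd(1), of A v]
        solves_sol(1)[OF nd(2), of A v] v(2) by (simp add: solves_def)
    have "(\<Sum>m<k. S i m * ?x m) = B v (A i)" "(\<Sum>m<k. S' i m * ?x m) = B v (A i)"
      using solves_sol(1)[OF nd(1), of A v] solves_sol(1)[OF nd(2), of A v] True v(2) v'
      by (simp_all add: solves_def)
    then show ?thesis using True by (simp add: if_distrib sum.delta cong: if_cong)
  qed
  then show "S = S'" by blast
qed

text \<open>\<open>S\<close> is the Gram matrix of \<open>b\<close> in the basis \<open>A\<close>.
  Self-adjointness of \<open>T\<close> shows that the coordinates of \<open>T v\<close> solve the
  system (\<open>key\<close>); by uniqueness \<open>T\<close> is the map built from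
  \<open>S\<close>.\<close>

lemma shift_of_surj:
  assumes A: "A \<in> frames k" and T: "T \<in> shifts" and im: "T ` V = span (A ` {..<k})"
  shows "\<exists>S\<in>nsym_diag {..<k} (\<lambda>i. nu (A i)). T = shift_of k A S"
proof -
  note t = shiftsD[OF T] and AV = frames_in_V[OF A]
  have "\<exists>u\<in>V. T u = A i" if "i < k" for i
  proof -
    have "A i \<in> T ` V" using span_base[of "A i" "A ` {..<k}"] that by (simp add: im)
    then show ?thesis by auto
  qed
  then obtain u where u: "\<And>i. i < k \<Longrightarrow> u i \<in> V" "\<And>i. i < k \<Longrightarrow> T (u i) = A i"
    by metis
  \<comment> \<open>The entry \<open>b (A i) (A j)\<close>, computed from a preimage
    \<open>u i\<close> of \<open>A i\<close>; by self-adjointness any preimage gives the same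
    value.\<close>
  define S where "S = (\<lambda>i j. if i < k \<and> j < k then B (u i) (A j) else 0)"
  have key: "(\<Sum>j<k. S i j * x j) = B v (A i)"
    if "i < k" "v \<in> V" "T v = comb k A x" for i v x
  proof -
    have "(\<Sum>j<k. S i j * x j) = B (u i) (comb k A x)"
      using that(1) u AV by (simp add: B_comb S_def mult.commute)
    also have "\<dots> = B v (A i)"
      using shift_self_adjoint[OF T, of "u i" v] that u by simp
    finally show ?thesis .
  qed
  have coords: "\<exists>x\<in>fsupp {..<k}. T v = comb k A x" if "v \<in> V" for v
    using im that by (auto simp: span_eq_comb)
  have nd: "nondeg {..<k} S"
    unfolding nondeg_def
  proof (intro allI impI)
    fix y :: "nat \<Rightarrow> 'k" assume y: "\<forall>i\<in>{..<k}. (\<Sum>j<k. S i j * y j) = 0"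
    define x where "x = (\<lambda>i. if i < k then y i else 0)"
    have x: "x \<in> fsupp {..<k}" by (auto simp: x_def fsupp_def)
    then have "comb k A x \<in> T ` V" by (simp add: im span_eq_comb)
    then obtain v where v: "v \<in> V" "T v = comb k A x" by auto
    have "(\<Sum>j<k. S i j * x j) = (\<Sum>j<k. S i j * y j)" for i by (simp add: x_def)
    then have vA: "B v (A i) = 0" if "i < k" for i using key[OF that v] y that by simp
    \<comment> \<open>A kernel vector yields a \<open>v\<close> orthogonal to the image of
      \<open>T\<close>; self-adjointness turns this into orthogonality of \<open>T v\<close> to all
      of \<open>V\<close>.\<close>
    have "B (T v) w = 0" if w: "w \<in> V" for w
    proof -
      obtain z where z: "T w = comb k A z" using coords w by blast
      have "B w (T v) = B v (T w)" using shift_self_adjoint[OF T w v(1)] .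
      also have "\<dots> = 0" using v AV vA by (simp add: z B_comb)
      finally show ?thesis using B_sym[OF w t(2)[OF v(1)]] by simp
    qed
    then have "T v = 0" using B_nondeg[OF t(2)[OF v(1)]] by blast
    then have "comb k A x = comb k A (\<lambda>_. 0)" using v(2) by (simp add: comb_def)
    then have "x = (\<lambda>_. 0)"
      by (rule inj_onD[OF inj_on_comb[OF frames_indep_seq[OF A]]]) (use x in \<open>auto simp: fsupp_def\<close>)
    then show "\<forall>i\<in>{..<k}. y i = 0" unfolding x_def by (metis lessThan_iff)
  qed
  have "S i j = S j i" for i j
  proof (cases "i < k \<and> j < k")
    case True
    then have "B (u i) (T (u j)) = B (u j) (T (u i))" using u by (intro shift_self_adjoint[OF T]) auto
    then show ?thesis using True u by (simp add: S_def)
  qed (auto simp: S_def)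
  moreover have "S i i = nu (A i)" if "i < k" for i
    using that u t(6)[of "u i"] by (simp add: S_def)
  moreover have "S i j = 0" if "i \<notin> {..<k}" for i j using that by (simp add: S_def)
  ultimately have "S \<in> nsym_diag {..<k} (\<lambda>i. nu (A i))"
    using nd unfolding nsym_diag_def nsym_def by blast
  moreover have "T = shift_of k A S"
  proof
    fix v
    show "T v = shift_of k A S v"
    proof (cases "v \<in> V")
      case True
      then obtain x where x: "x \<in> fsupp {..<k}" "T v = comb k A x" using coords by blast
      then have "solves k A S v x" using key True by (simp add: solves_def)
      then show ?thesis using solves_sol(2)[OF nd] x True by (simp add: shift_of_def)
    qed (simp add: t shift_of_def)
  qed
  ultimately show ?thesis by blast
qed

lemma card_shifts_frame:
  assumes A: "A \<in> frames k"
  shows "card {T \<in> shifts. T ` V = span (A ` {..<k})} = card (nsym_diag {..<k} (\<lambda>i. nu (A i)))"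
proof -
  have "bij_betw (shift_of k A) (nsym_diag {..<k} (\<lambda>i. nu (A i)))
    {T \<in> shifts. T ` V = span (A ` {..<k})}"
    unfolding bij_betw_def
  proof (intro conjI equalityI subsetI)
    fix T assume "T \<in> {T \<in> shifts. T ` V = span (A ` {..<k})}"
    then show "T \<in> shift_of k A ` nsym_diag {..<k} (\<lambda>i. nu (A i))"
      using shift_of_surj[OF A] by blast
  next
    fix T assume "T \<in> shift_of k A ` nsym_diag {..<k} (\<lambda>i. nu (A i))"
    then show "T \<in> {T \<in> shifts. T ` V = span (A ` {..<k})}"
      using shift_of_in_shifts[OF A] shift_of_image[OF A] by blast
  qed (rule inj_on_shift_of[OF A])
  then show ?thesis by (simp add: bij_betw_same_card)
qed

section \<open>Counting shifts by rank\<close>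

definition rank_shifts :: "nat \<Rightarrow> ('v \<Rightarrow> 'v) set" where
  "rank_shifts k = {T \<in> shifts. card (T ` V) = q ^ k}"

text \<open>The image of a shift is isotropic, so all its ordered bases are frames, and
  \<open>card_bases\<close> counts them.\<close>

lemma frames_of_image:
  assumes T: "T \<in> rank_shifts k"
  shows "card {A \<in> frames k. T ` V = span (A ` {..<k})} = (\<Prod>i<k. q ^ k - q ^ i)"
proof -
  let ?W = "T ` V"
  have T': "T \<in> shifts" and c: "card ?W = q ^ k" using T by (auto simp: rank_shifts_def)
  note sub = subspace_shift_image[OF T']
  have fW: "finite ?W" using finite_V by simp
  have WV: "?W \<subseteq> V" using shiftsD[OF T'] by auto
  have "{A \<in> frames k. ?W = span (A ` {..<k})} = tuples (\<lambda>j A. ?W - span (A ` {..<j})) k"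
  proof
    have "A j \<in> span (A ` {..<k})" if "j < k" for A :: "nat \<Rightarrow> 'v" and j
      using that by (intro span_base) auto
    then show "{A \<in> frames k. ?W = span (A ` {..<k})} \<subseteq> tuples (\<lambda>j A. ?W - span (A ` {..<j})) k"
      by (auto simp: frames_def tuples_def)
    show "tuples (\<lambda>j A. ?W - span (A ` {..<j})) k \<subseteq> {A \<in> frames k. ?W = span (A ` {..<k})}"
    proof
      fix A assume A: "A \<in> tuples (\<lambda>j A. ?W - span (A ` {..<j})) k"
      have AW: "A j \<in> ?W" if "j < k" for j using A that by (auto simp: tuples_def)
      have sW: "span (A ` {..<j}) \<subseteq> ?W" if "j \<le> k" for j
        using AW that by (intro span_minimal sub) auto
      have "A j \<in> perp (span (A ` {..<j}))" if "j < k" for j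
      proof -
        have "B (A j) w = 0" if "w \<in> span (A ` {..<j})" for w
          using sW[of j] AW[OF \<open>j < k\<close>] that \<open>j < k\<close> shift_image_isotropic[OF T'] by fastforce
        then show ?thesis using AW[OF that] WV by (auto simp: perp_def)
      qed
      then have "A \<in> frames k" using A by (auto simp: frames_def tuples_def)
      moreover have "span (A ` {..<k}) = ?W"
        using card_subset_eq[OF fW sW[of k]] c card_span_indep_seq[OF frames_indep_seq[OF \<open>A \<in> frames k\<close>]]
        by simp
      ultimately show "A \<in> {A \<in> frames k. ?W = span (A ` {..<k})}" by simp
    qed
  qed
  then show ?thesis using card_bases[OF fW c sub] by simp
qed

text \<open>Double counting of the pairs of a shift and a frame spanning its image. For a fixed
  frame the shifts correspond to Gram matrices, whose diagonal is zero exactly for singular frames.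
  For \<open>k = 0\<close> the only frame is singular, so the truncated \<open>k - 1\<close> meets a
  factor 0.\<close>

lemma card_rank_shifts:
  assumes "k \<le> n"
  shows "card (rank_shifts k) * (\<Prod>i<k. q ^ k - q ^ i) =
    (card (frames k) - card (sing_frames k)) * num_sym q (k - 1) + card (sing_frames k) * num_alt q k"
proof -
  have sub: "sing_frames k \<subseteq> frames k" by (auto simp: sing_frames_eq)
  have "(\<Sum>A\<in>frames k. card {T \<in> rank_shifts k. T ` V = span (A ` {..<k})})
      = (\<Prod>i<k. q ^ k - q ^ i) * card (rank_shifts k)"
    by (rule sum_multicount)
       (use frames_of_image finite_frames finite_shifts in \<open>auto simp: rank_shifts_def\<close>)
  moreover have "card {T \<in> rank_shifts k. T ` V = span (A ` {..<k})}
      = (if A \<in> sing_frames k then num_alt q k else num_sym q (k - 1))" if A: "A \<in> frames k" for A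
  proof -
    have "{T \<in> rank_shifts k. T ` V = span (A ` {..<k})} = {T \<in> shifts. T ` V = span (A ` {..<k})}"
      using card_span_indep_seq[OF frames_indep_seq[OF A]] by (auto simp: rank_shifts_def)
    then have "card {T \<in> rank_shifts k. T ` V = span (A ` {..<k})}
        = card (nsym_diag {..<k} (\<lambda>i. nu (A i)))" using card_shifts_frame[OF A] by simp
    also have "\<dots> = (if A \<in> sing_frames k then num_alt q k else num_sym q (k - 1))"
    proof (cases "A \<in> sing_frames k")
      case True
      then have "nsym_diag {..<k} (\<lambda>i. nu (A i)) = nsym_diag {..<k} (\<lambda>_. 0)"
        by (auto simp: sing_frames_eq nsym_diag_def)
      then show ?thesis using True card_nsym_diag_zero[of "{..<k}"] by simp
    next
      case False
      then obtain i where "i < k" "nu (A i) \<noteq> 0" using A by (auto simp: sing_frames_eq)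
      then show ?thesis using False card_nsym_diag[of "{..<k}" i "\<lambda>i. nu (A i)"] by simp
    qed
    finally show ?thesis .
  qed
  ultimately have "card (rank_shifts k) * (\<Prod>i<k. q ^ k - q ^ i)
      = (\<Sum>A\<in>frames k. if A \<in> sing_frames k then num_alt q k else num_sym q (k - 1))"
    by (simp add: mult.commute)
  also have "\<dots> = card (sing_frames k) * num_alt q k
      + card (frames k - sing_frames k) * num_sym q (k - 1)"
    using finite_frames sub by (simp add: sum.If_cases Int_absorb1 Diff_eq[symmetric])
  finally show ?thesis
    using sub finite_frames[of k] by (simp add: card_Diff_subset finite_subset)
qed

text \<open>Ranks stop at \<open>n\<close> because an isotropic \<open>W\<close> satisfies
  \<open>card W * card W \<le> card V\<close>.\<close>

lemma card_shifts: "card shifts = (\<Sum>k\<le>n. card (rank_shifts k))"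
proof -
  have "shifts = (\<Union>k\<le>n. rank_shifts k)"
  proof
    show "shifts \<subseteq> (\<Union>k\<le>n. rank_shifts k)"
    proof
      fix T assume T: "T \<in> shifts"
      note sub = subspace_shift_image[OF T]
      have WV: "T ` V \<subseteq> V" using shiftsD[OF T] by auto
      obtain k where k: "card (T ` V) = q ^ k" using card_subspace[OF sub] finite_V by blast
      have "T ` V \<subseteq> perp (T ` V)"
        using shift_image_isotropic[OF T] WV by (auto simp: perp_def)
      then have "card (T ` V) \<le> card (perp (T ` V))" by (intro card_mono finite_perp)
      then have "card (T ` V) * card (T ` V) \<le> q ^ (2 * n)"
        using card_perp[OF sub WV] by (metis card_V mult_le_mono1)
      then have "q ^ (k + k) \<le> q ^ (2 * n)" by (simp add: k power_add)
      then have "k + k \<le> 2 * n" using q_ge_2 by (subst (asm) power_increasing_iff) auto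
      then show "T \<in> (\<Union>k\<le>n. rank_shifts k)" using T k by (auto simp: rank_shifts_def)
    qed
  qed (auto simp: rank_shifts_def)
  then have "card shifts = card (\<Union>k\<le>n. rank_shifts k)" by simp
  also have "\<dots> = (\<Sum>k\<le>n. card (rank_shifts k))"
    by (rule card_UN_disjoint) (use finite_shifts q_ge_2 in \<open>auto simp: rank_shifts_def power_inject_exp\<close>)
  finally show ?thesis .
qed

end

section \<open>Involutions as matrices\<close>

lemma (in quadratic_space) shift_comb:
  assumes T: "T \<in> shifts" and A: "\<And>i. i < k \<Longrightarrow> A i \<in> V"
  shows "T (comb k A x) = comb k (\<lambda>i. T (A i)) x"
  using A
proof (induction k)
  case 0
  then show ?case using shiftsD(4)[OF T V_0, of 0] by (simp add: comb_0)
next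
  case (Suc k)
  then show ?case by (simp add: comb_Suc shiftsD[OF T] comb_in_V V_scale)
qed

text \<open>The action of a matrix on finitely supported functions. With pointwise addition these
  live in a type that is an abelian group, as \<open>quadratic_space\<close> demands of its ambient
  type.\<close>

definition mat_fun :: "nat \<Rightarrow> 'k::field mat \<Rightarrow> (nat \<Rightarrow> 'k) \<Rightarrow> nat \<Rightarrow> 'k" where
  "mat_fun N g f = (\<lambda>i. if i < N then \<Sum>j<N. g $$ (i, j) * f j else 0)"

abbreviation coords :: "nat \<Rightarrow> (nat \<Rightarrow> 'k::field) set" where
  "coords N \<equiv> {f. \<forall>i\<ge>N. f i = 0}"

lemma mat_fun_in_coords: "mat_fun N g f \<in> coords N"
  by (simp add: mat_fun_def)

lemma vec_mat_fun: "g \<in> carrier_mat N N \<Longrightarrow> vec N (mat_fun N g f) = g *\<^sub>v vec N f"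
  by (rule eq_vecI) (auto simp: mat_fun_def scalar_prod_def atLeast0LessThan)

lemma vec_inj: "f \<in> coords N \<Longrightarrow> g \<in> coords N \<Longrightarrow> vec N f = vec N g \<Longrightarrow> f = g"
  by (auto simp: fun_eq_iff vec_eq_iff) (metis not_le)

lemma vec_add: "vec N (f + g) = vec N f + vec N g"
  by (rule eq_vecI) auto

lemma vec_scale: "vec N (\<lambda>i. c * f i) = c \<cdot>\<^sub>v vec N f"
  by (rule eq_vecI) auto

lemma mat_fun_mult:
  assumes "g \<in> carrier_mat N N" "h \<in> carrier_mat N N"
  shows "mat_fun N (g * h) f = mat_fun N g (mat_fun N h f)"
proof (rule vec_inj[OF mat_fun_in_coords mat_fun_in_coords])
  show "vec N (mat_fun N (g * h) f) = vec N (mat_fun N g (mat_fun N h f))"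
    using assms by (simp add: vec_mat_fun assoc_mult_mat_vec[of _ N N _ N])
qed

lemma mat_fun_one: "f \<in> coords N \<Longrightarrow> mat_fun N (1\<^sub>m N) f = f"
  by (rule vec_inj[OF mat_fun_in_coords]) (auto simp: vec_mat_fun)

lemma mat_fun_add: "mat_fun N g (f + h) = mat_fun N g f + mat_fun N g h"
  by (auto simp: mat_fun_def fun_eq_iff distrib_left sum.distrib)

lemma mat_fun_scale: "mat_fun N g (\<lambda>i. c * f i) = (\<lambda>i. c * mat_fun N g f i)"
  by (auto simp: mat_fun_def fun_eq_iff sum_distrib_left mult.left_commute)

lemma mat_fun_inj:
  assumes g: "g \<in> carrier_mat N N" "h \<in> carrier_mat N N"
    and e: "\<And>f. f \<in> coords N \<Longrightarrow> mat_fun N g f = mat_fun N h f"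
  shows "g = h"
proof (rule eq_matI)
  fix i j assume ij: "i < dim_row h" "j < dim_col h"
  let ?e = "\<lambda>m. if m = j then 1 else 0 :: 'a"
  have "?e \<in> coords N" using ij g by auto
  from fun_cong[OF e[OF this], of i] show "g $$ (i, j) = h $$ (i, j)"
    using ij g by (simp add: mat_fun_def if_distrib sum.delta cong: if_cong)
qed (use g in auto)

lemma sum_fun_apply: "(\<Sum>i\<in>I. f i) x = (\<Sum>i\<in>I. f i x)"
  by (induction I rule: infinite_finite_induct) auto

context
  fixes q n :: nat and \<nu> :: "'k::{field,finite} vec \<Rightarrow> 'k"
  assumes char2: "(2::'k) = 0" and cardK: "CARD('k) = q"
    and nondeg_form: "nondegenerate_quadratic_form (2 * n) \<nu>"
begin

abbreviation coord_scale :: "'k \<Rightarrow> (nat \<Rightarrow> 'k) \<Rightarrow> nat \<Rightarrow> 'k" where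
  "coord_scale c f \<equiv> (\<lambda>i. c * f i)"

abbreviation coord_form :: "(nat \<Rightarrow> 'k) \<Rightarrow> 'k" where
  "coord_form f \<equiv> \<nu> (vec (2 * n) f)"

abbreviation coord_polar :: "(nat \<Rightarrow> 'k) \<Rightarrow> (nat \<Rightarrow> 'k) \<Rightarrow> 'k" where
  "coord_polar f g \<equiv> polar_form \<nu> (vec (2 * n) f) (vec (2 * n) g)"

lemma quadratic_space_coords:
  "quadratic_space q coord_scale (coords (2 * n)) n coord_form coord_polar"
proof -
  interpret char_two_field "TYPE('k)" q by unfold_locales (rule char2 cardK)+
  interpret vector_space coord_scale
    by unfold_locales (auto simp: fun_eq_iff algebra_simps)
  have fs: "(coords (2 * n) :: (nat \<Rightarrow> 'k) set) = fsupp {..<2 * n}" by (auto simp: fsupp_def)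
  note nd = nondeg_form[unfolded nondegenerate_quadratic_form_def quadratic_form_def]
  show ?thesis
  proof
    show "subspace (coords (2 * n))" by (auto intro!: subspaceI)
    show "card (coords (2 * n) :: (nat \<Rightarrow> 'k) set) = q ^ (2 * n)" by (simp add: fs card_fsupp)
    show "coord_form (coord_scale a v) = a\<^sup>2 * coord_form v" for a v using nd by (simp add: vec_scale)
    show "coord_form (v + w) = coord_form v + coord_form w + coord_polar v w" for v w
      by (simp add: vec_add polar_form_def add_ac)
    show "coord_polar (u + v) w = coord_polar u w + coord_polar v w" for u v w
      using nd by (simp add: vec_add)
    show "coord_polar (coord_scale a v) w = a * coord_polar v w" for a v w
      using nd by (simp add: vec_scale)
    show "v = 0" if v: "v \<in> coords (2 * n)" and z: "\<And>w. w \<in> coords (2 * n) \<Longrightarrow> coord_polar v w = 0" for v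
    proof -
      have "polar_form \<nu> (vec (2 * n) v) w = 0" if w: "w \<in> carrier_vec (2 * n)" for w
      proof -
        let ?f = "\<lambda>i. if i < 2 * n then w $ i else 0"
        have "vec (2 * n) ?f = w" using w by (intro eq_vecI) auto
        moreover have "coord_polar v ?f = 0" by (rule z) auto
        ultimately show ?thesis by simp
      qed
      then have "vec (2 * n) v = 0\<^sub>v (2 * n)" using nd by simp
      also have "0\<^sub>v (2 * n) = vec (2 * n) (0 :: nat \<Rightarrow> 'k)" by (rule eq_vecI) auto
      finally show "v = 0" using v by (intro vec_inj[of v "2 * n" 0]) auto
    qed
  qed
qed

interpretation qs: quadratic_space "TYPE('k)" q coord_scale "coords (2 * n)" n coord_form coord_polar
  by (rule quadratic_space_coords)

text \<open>This is \<open>g - 1\<close>, written with a plus in characteristic 2. The value 0 off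
  the space is the normalization in \<open>shifts\<close>, needed for a bijection of
  functions.\<close>

definition shift_of_mat :: "'k mat \<Rightarrow> (nat \<Rightarrow> 'k) \<Rightarrow> nat \<Rightarrow> 'k" where
  "shift_of_mat g f = (if f \<in> coords (2 * n) then mat_fun (2 * n) g f + f else 0)"

lemma shift_of_mat_in_shifts:
  assumes "g \<in> involutions (2 * n) (orthogonal_group (2 * n) \<nu>)"
  shows "shift_of_mat g \<in> qs.shifts"
proof -
  have g: "g \<in> carrier_mat (2 * n) (2 * n)" "g * g = 1\<^sub>m (2 * n)"
    and iso: "v \<in> carrier_vec (2 * n) \<Longrightarrow> \<nu> (g *\<^sub>v v) = \<nu> v" for v
    using assms by (auto simp: involutions_def orthogonal_group_def)
  let ?M = "mat_fun (2 * n) g" and ?T = "shift_of_mat g"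
  note inV = mat_fun_in_coords[of "2 * n" g] and Vadd = qs.V_add and Vscl = qs.V_scale
  have T: "?T f = ?M f + f" if "f \<in> coords (2 * n)" for f
    unfolding shift_of_mat_def using that by (simp only: if_True)
  have MM: "?M (?M f) = f" if "f \<in> coords (2 * n)" for f
    using mat_fun_mult[OF g(1) g(1), of f] mat_fun_one[OF that] g(2) by simp
  have nuM: "coord_form (?M f) = coord_form f" for f
    using iso[of "vec (2 * n) f"] by (simp add: vec_mat_fun[OF g(1)])
  have TV: "?T f \<in> coords (2 * n)" if "f \<in> coords (2 * n)" for f
    unfolding T[OF that] by (rule Vadd[OF inV that])
  have "?T (v + w) = ?T v + ?T w" if "v \<in> coords (2 * n)" "w \<in> coords (2 * n)" for v w
    unfolding T[OF that(1)] T[OF that(2)] T[OF Vadd[OF that]] by (simp add: mat_fun_add add_ac)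
  moreover have "?T (coord_scale a v) = coord_scale a (?T v)" if "v \<in> coords (2 * n)" for a v
    unfolding T[OF that] T[OF Vscl[OF that]] by (simp add: mat_fun_scale fun_eq_iff distrib_left)
  moreover have "?T (?T v) = 0" if v: "v \<in> coords (2 * n)" for v
  proof -
    have "?T (?T v) = ?M (?M v + v) + (?M v + v)"
      using T[OF TV[OF v]] by (simp only: T[OF v])
    also have "\<dots> = (?M v + v) + (?M v + v)" by (simp only: mat_fun_add MM[OF v] add_ac)
    also have "\<dots> = 0" by (rule qs.vadd_self)
    finally show ?thesis .
  qed
  moreover have "coord_form (?T v) = coord_polar v (?T v)" if v: "v \<in> coords (2 * n)" for v
  proof -
    \<comment> \<open>The first two terms cancel since \<open>g\<close> preserves the form; adding
      \<open>coord_polar v v = 0\<close> then completes \<open>?M v\<close> to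
      \<open>?T v\<close>.\<close>
    have "coord_form (?T v) = coord_form (?M v) + coord_form v + coord_polar (?M v) v"
      unfolding T[OF v] by (rule qs.nu_add[OF inV v])
    also have "\<dots> = coord_polar v (?M v) + coord_polar v v"
      unfolding nuM qs.B_sym[OF inV v] qs.B_alt[OF v] by simp
    also have "\<dots> = coord_polar v (?T v)"
      unfolding T[OF v] by (rule qs.B_add_right[OF inV v v, symmetric])
    finally show ?thesis .
  qed
  moreover have "?T v = 0" if "v \<notin> coords (2 * n)" for v
    unfolding shift_of_mat_def using that by (simp only: if_False)
  ultimately show ?thesis
    unfolding qs.shifts_def using TV by blast
qed

lemma shift_of_mat_surj:
  assumes T: "T \<in> qs.shifts"
  shows "\<exists>g\<in>involutions (2 * n) (orthogonal_group (2 * n) \<nu>). T = shift_of_mat g"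
proof -
  let ?V = "coords (2 * n)"
  note t = qs.shiftsD[OF T]
  define e where "e = (\<lambda>(j :: nat) m. if m = j then 1 else 0 :: 'k)"
  \<comment> \<open>Column \<open>j\<close> is the image of the unit vector \<open>e j\<close> under
    \<open>1 + T\<close>.\<close>
  define g where "g = mat (2 * n) (2 * n) (\<lambda>(i, j). T (e j) i + (if i = j then 1 else 0))"
  have g: "g \<in> carrier_mat (2 * n) (2 * n)" by (simp add: g_def)
  have eV: "e j \<in> ?V" if "j < 2 * n" for j using that by (auto simp: e_def)
  have M: "mat_fun (2 * n) g f = T f + f" if f: "f \<in> ?V" for f
  proof -
    have f_eq: "f = qs.comb (2 * n) e f"
    proof
      fix i show "f i = qs.comb (2 * n) e f i"
        using f by (auto simp: qs.comb_def sum_fun_apply e_def if_distrib sum.delta' cong: if_cong)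
    qed
    have "T f = qs.comb (2 * n) (\<lambda>j. T (e j)) f"
      using qs.shift_comb[OF T, of "2 * n" e f] eV f_eq by simp
    then have Tf: "T f i = (\<Sum>j<2 * n. f j * T (e j) i)" for i
      by (simp add: qs.comb_def sum_fun_apply)
    show ?thesis
    proof
      fix i show "mat_fun (2 * n) g f i = (T f + f) i"
      proof (cases "i < 2 * n")
        case True
        then have "mat_fun (2 * n) g f i
            = (\<Sum>j<2 * n. f j * T (e j) i + (if j = i then f j else 0))"
          unfolding mat_fun_def by (simp only: if_True, intro sum.cong)
            (auto simp: g_def distrib_left mult.commute)
        also have "\<dots> = T f i + f i" using True by (simp add: Tf sum.distrib)
        finally show ?thesis by simp
      next
        case False
        then show ?thesis using f t(2)[OF f] by (simp add: mat_fun_def)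
      qed
    qed
  qed
  have TT: "T f = shift_of_mat g f" for f
  proof (cases "f \<in> ?V")
    case True
    have "T f = (T f + f) + f" by (simp only: add.assoc qs.vadd_self add_0_right)
    then show ?thesis unfolding shift_of_mat_def M[OF True] using True by (simp only: if_True)
  next
    case False
    then show ?thesis using t(1) by (simp only: shift_of_mat_def if_False)
  qed
  have "mat_fun (2 * n) (g * g) f = mat_fun (2 * n) (1\<^sub>m (2 * n)) f" if f: "f \<in> ?V" for f
  proof -
    have "mat_fun (2 * n) (g * g) f = T (T f + f) + (T f + f)"
      unfolding mat_fun_mult[OF g g] M[OF f] by (rule M[OF qs.V_add[OF t(2)[OF f] f]])
    also have "\<dots> = (T f + T f) + f" unfolding t(3)[OF t(2)[OF f] f] t(5)[OF f] by (simp only: add_0 add.assoc)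
    also have "\<dots> = f" by (simp only: qs.vadd_self add_0)
    finally show ?thesis unfolding mat_fun_one[OF f] .
  qed
  then have gg: "g * g = 1\<^sub>m (2 * n)"
    using g by (intro mat_fun_inj[of _ "2 * n"]) auto
  have "\<nu> (g *\<^sub>v v) = \<nu> v" if v: "v \<in> carrier_vec (2 * n)" for v
  proof -
    define f where "f = (\<lambda>i. if i < 2 * n then v $ i else 0)"
    have f: "f \<in> ?V" "vec (2 * n) f = v" using v by (auto simp: f_def)
    have "\<nu> (g *\<^sub>v v) = coord_form (T f + f)"
      using vec_mat_fun[OF g, of f] by (simp only: f(2) M[OF f(1)])
    also have "\<dots> = coord_form f + (coord_form (T f) + coord_polar (T f) f)"
      unfolding qs.nu_add[OF t(2)[OF f(1)] f(1)] by (simp only: add_ac)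
    also have "coord_form (T f) + coord_polar (T f) f = 0"
      unfolding t(6)[OF f(1)] qs.B_sym[OF t(2)[OF f(1)] f(1)] by (rule qs.add_self)
    finally show ?thesis using f(2) by simp
  qed
  moreover have "invertible_mat g"
    unfolding invertible_mat_def inverts_mat_def using g gg by auto
  ultimately have "g \<in> involutions (2 * n) (orthogonal_group (2 * n) \<nu>)"
    using g gg by (simp add: involutions_def orthogonal_group_def)
  then show ?thesis using TT by blast
qed

lemma card_involutions:
  "card (involutions (2 * n) (orthogonal_group (2 * n) \<nu>)) = card qs.shifts"
proof -
  let ?I = "involutions (2 * n) (orthogonal_group (2 * n) \<nu>)"
  have "inj_on shift_of_mat ?I"
  proof (rule inj_onI)
    fix g h assume gh: "g \<in> ?I" "h \<in> ?I" and e: "shift_of_mat g = shift_of_mat h"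
    have "mat_fun (2 * n) g f = mat_fun (2 * n) h f" if "f \<in> coords (2 * n)" for f
    proof -
      have "mat_fun (2 * n) g f + f = mat_fun (2 * n) h f + f"
        using fun_cong[OF e, of f] that by (simp only: shift_of_mat_def if_True)
      then show ?thesis by (simp only: add_right_cancel)
    qed
    then show "g = h"
      using gh by (intro mat_fun_inj[of _ "2 * n"]) (auto simp: involutions_def orthogonal_group_def)
  qed
  moreover have "shift_of_mat ` ?I = qs.shifts"
    using shift_of_mat_in_shifts shift_of_mat_surj by blast
  ultimately show ?thesis using card_image by fastforce
qed

text \<open>The interface to the analysis: only numbers leave this context. \<open>I k\<close>
  counts the shifts of rank \<open>k\<close>, and \<open>Z k\<close> the singular frames of length
  \<open>k\<close>; the form enters the identities through \<open>Z\<close> alone.\<close>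

lemma involution_rank_counts:
  "\<exists>I Z. card (involutions (2 * n) (orthogonal_group (2 * n) \<nu>)) = (\<Sum>k\<le>n. I k) \<and>
    (\<forall>k\<le>n. I k * (\<Prod>i<k. q ^ k - q ^ i) =
        ((\<Prod>i<k. q ^ (2 * n - i) - q ^ i) - Z k) * num_sym q (k - 1) + Z k * num_alt q k \<and>
      Z k \<le> (\<Prod>i<k. q ^ (2 * n - i) - q ^ i) \<and>
      real (Z k) \<le> (\<Prod>i<k. 3/4 * real q ^ (2 * n - i)))"
proof (intro exI conjI allI impI)
  show "card (involutions (2 * n) (orthogonal_group (2 * n) \<nu>)) = (\<Sum>k\<le>n. card (qs.rank_shifts k))"
    by (simp only: card_involutions qs.card_shifts)
  fix k assume k: "k \<le> n"
  show "card (qs.rank_shifts k) * (\<Prod>i<k. q ^ k - q ^ i) =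
      ((\<Prod>i<k. q ^ (2 * n - i) - q ^ i) - card (qs.sing_frames k)) * num_sym q (k - 1)
      + card (qs.sing_frames k) * num_alt q k"
    using qs.card_rank_shifts[OF k] by (simp only: qs.card_frames[OF k])
  show "card (qs.sing_frames k) \<le> (\<Prod>i<k. q ^ (2 * n - i) - q ^ i)"
    unfolding qs.card_frames[OF k, symmetric]
    by (intro card_mono qs.finite_frames) (auto simp only: qs.sing_frames_eq)
  show "real (card (qs.sing_frames k)) \<le> (\<Prod>i<k. 3/4 * real q ^ (2 * n - i))"
    by (rule qs.card_sing_frames[OF k])
qed

end

section \<open>Asymptotics\<close>

lemma prod_LIMSEQ:
  fixes f :: "nat \<Rightarrow> real"
  assumes "summable (\<lambda>i. norm (f i - 1))"
  shows "(\<lambda>n. \<Prod>i<n. f i) \<longlonglongrightarrow> prodinf f" and "(\<And>i. f i \<noteq> 0) \<Longrightarrow> prodinf f \<noteq> 0"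
proof -
  have c: "convergent_prod f"
    using assms by (intro abs_convergent_prod_imp_convergent_prod summable_imp_abs_convergent_prod)
  show "(\<lambda>n. \<Prod>i<n. f i) \<longlonglongrightarrow> prodinf f"
    using convergent_prod_LIMSEQ[OF c]
    by (subst filterlim_sequentially_Suc[symmetric]) (simp add: lessThan_Suc_atMost)
  show "(\<And>i. f i \<noteq> 0) \<Longrightarrow> prodinf f \<noteq> 0" by (rule prodinf_nonzero[OF c])
qed

text \<open>For fixed \<open>k\<close> the term tends to 0 with \<open>n\<close>, and it is
  dominated by \<open>C * a k\<close>, where \<open>C\<close> bounds \<open>b\<close>; Tannery's
  theorem allows the termwise limit.\<close>

lemma convolution_tendsto_0:
  fixes b :: "nat \<Rightarrow> real"
  assumes a: "summable a" "\<And>k. 0 \<le> a k" and b: "b \<longlonglongrightarrow> 0"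
  shows "(\<lambda>n. \<Sum>k\<le>n. a k * b (n - k)) \<longlonglongrightarrow> 0"
proof -
  define f where "f = (\<lambda>k n. if k \<le> n then a k * b (n - k) else 0)"
  obtain C where C: "\<And>n. norm (b n) \<le> C" using b Bseq_def convergent_imp_Bseq convergentI by metis
  have lim: "(f k \<longlongrightarrow> 0) sequentially" for k
  proof -
    have "(\<lambda>n. a k * b (n - k)) \<longlonglongrightarrow> a k * 0"
      by (intro tendsto_mult tendsto_const filterlim_compose[OF b] filterlim_minus_const_nat_at_top)
    then have "(\<lambda>n. a k * b (n - k)) \<longlonglongrightarrow> 0" by simp
    then show ?thesis
      by (rule Lim_transform_eventually) (auto simp: f_def eventually_at_top_linorder)
  qed
  have bd: "norm (f k n) \<le> C * a k" for k n
    using a(2)[of k] C[of "n - k"] C[of 0] mult_left_mono[OF C a(2)]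
    by (auto simp: f_def abs_mult mult.commute)
  have "(\<lambda>n. suminf (\<lambda>k. f k n)) \<longlonglongrightarrow> suminf (\<lambda>_. 0 :: real)"
  proof -
    have "eventually (\<lambda>(k, n). norm (f k n) \<le> C * a k) (at_top \<times>\<^sub>F sequentially)"
      using bd by (intro always_eventually) auto
    from tannerys_theorem[OF lim this] show ?thesis using a(1) by (simp add: summable_mult)
  qed
  moreover have "suminf (\<lambda>k. f k n) = (\<Sum>k\<le>n. a k * b (n - k))" for n
    by (subst suminf_finite[of "{..n}"]) (auto simp: f_def)
  ultimately show ?thesis by simp
qed

context
  fixes q :: nat and x :: real
  assumes q: "q \<ge> 2" and x_def: "x = 1 / real q"
begin

section \<open>Pochhammer products and proportions of nondegenerate matrices\<close>

text \<open>In Pochhammer notation these three products are \<open>(x^2; x^2)_m\<close>,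
  \<open>(x; x)_m\<close> and \<open>(x; x^2)_m\<close>.\<close>

definition even_poch :: "nat \<Rightarrow> real" where "even_poch m = (\<Prod>l<m. 1 - x ^ (2 * l + 2))"
definition full_poch :: "nat \<Rightarrow> real" where "full_poch m = (\<Prod>l<m. 1 - x ^ (l + 1))"
definition odd_poch :: "nat \<Rightarrow> real" where "odd_poch m = (\<Prod>l<m. 1 - x ^ (2 * l + 1))"

lemma x_bounds: "0 < x" "x \<le> 1/2" "x < 1"
  using q by (auto simp: x_def field_simps)

lemma x_power: "0 < x ^ k" "x ^ k \<le> 1" "k > 0 \<Longrightarrow> x ^ k < 1"
  using x_bounds by (auto simp: power_le_one power_Suc_less_one intro: power_strict_decreasing[of 0, simplified])

lemma even_poch_pos: "0 < even_poch m" and full_poch_pos: "0 < full_poch m" and odd_poch_pos: "0 < odd_poch m"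
  unfolding even_poch_def full_poch_def odd_poch_def
  by ((intro prod_pos, simp only: diff_gt_0_iff_gt, intro x_power(3), simp)+)

lemma odd_poch_le_1: "odd_poch m \<le> 1"
proof -
  have "0 \<le> 1 - x ^ k \<and> 1 - x ^ k \<le> 1" for k using x_power(1,2)[of k] by simp
  then show ?thesis unfolding odd_poch_def by (intro prod_le_1)
qed

lemma full_poch_even: "full_poch (2 * m) = even_poch m * odd_poch m"
  by (induction m) (simp_all add: full_poch_def even_poch_def odd_poch_def algebra_simps)

text \<open>The exponents \<open>k * (k - 1) / 2\<close> and \<open>k * (k + 1) / 2\<close> are the
  numbers of free entries, so the ratios are the proportions of nondegenerate matrices among
  alternating and symmetric ones.\<close>

definition alt_ratio :: "nat \<Rightarrow> real" where "alt_ratio k = num_alt q k / real q ^ (\<Sum>i<k. i)"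
definition sym_ratio :: "nat \<Rightarrow> real" where "sym_ratio k = num_sym q k / real q ^ (\<Sum>i<Suc k. i)"

lemma alt_ratio_rec: "alt_ratio (Suc (Suc k)) = (1 - x ^ Suc k) * alt_ratio k"
proof -
  have "real (num_alt q (Suc (Suc k))) = (real q ^ Suc k - 1) * real q ^ k * num_alt q k"
    using q by (simp add: of_nat_diff)
  moreover have "real q ^ (\<Sum>i<Suc (Suc k). i) = real q ^ (\<Sum>i<k. i) * real q ^ k * real q ^ Suc k"
    by (simp add: power_add)
  ultimately show ?thesis using q by (simp add: alt_ratio_def x_def power_divide field_simps)
qed

text \<open>A weighted mean over the diagonal, which is zero for a proportion
  \<open>x ^ Suc k\<close> of the symmetric matrices.\<close>

lemma sym_ratio_rec: "sym_ratio (Suc k) = (1 - x ^ Suc k) * sym_ratio k + x ^ Suc k * alt_ratio (Suc k)"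
proof -
  define P where "P = real q ^ (\<Sum>i<Suc k. i)"
  define Q where "Q = real q ^ Suc k"
  have nz: "P \<noteq> 0" "Q \<noteq> 0" using q by (auto simp: P_def Q_def)
  have "real (num_sym q (Suc k)) = (Q - 1) * num_sym q k + num_alt q (Suc k)"
    using q by (simp add: of_nat_diff Q_def)
  moreover have "real q ^ (\<Sum>i<Suc (Suc k). i) = P * Q"
    unfolding P_def Q_def by (simp only: sum.lessThan_Suc[of _ "Suc k"] power_add)
  ultimately have "sym_ratio (Suc k) = ((Q - 1) * num_sym q k + num_alt q (Suc k)) / (P * Q)"
    by (simp only: sym_ratio_def)
  also have "\<dots> = (1 - 1 / Q) * (num_sym q k / P) + 1 / Q * (num_alt q (Suc k) / P)"
    using nz by (simp add: field_simps)
  also have "\<dots> = (1 - x ^ Suc k) * sym_ratio k + x ^ Suc k * alt_ratio (Suc k)"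
    by (simp only: sym_ratio_def alt_ratio_def P_def Q_def x_def power_divide power_one)
  finally show ?thesis .
qed

lemma alt_ratio_even_odd: "alt_ratio (2 * m) = odd_poch m" "alt_ratio (Suc (2 * m)) = 0"
  by (induction m) (simp_all add: alt_ratio_rec odd_poch_def, simp_all add: alt_ratio_def)

lemma sym_ratio_even_odd: "sym_ratio (2 * m) = odd_poch m \<and> sym_ratio (Suc (2 * m)) = odd_poch (Suc m)"
proof (induction m)
  case 0
  have "sym_ratio 0 = 1" by (simp add: sym_ratio_def)
  then show ?case using sym_ratio_rec[of 0] by (simp add: odd_poch_def alt_ratio_def)
next
  case (Suc m)
  \<comment> \<open>Both quantities averaged by the recursion equal \<open>odd_poch (Suc m)\<close>
    here, hence so does their mean.\<close>
  have e: "sym_ratio (2 * Suc m) = odd_poch (Suc m)"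
    using sym_ratio_rec[of "Suc (2 * m)"] Suc alt_ratio_even_odd(1)[of "Suc m"] by (simp add: algebra_simps)
  have "sym_ratio (Suc (2 * Suc m)) = (1 - x ^ Suc (2 * Suc m)) * odd_poch (Suc m)"
    using sym_ratio_rec[of "2 * Suc m"] e alt_ratio_even_odd(2)[of "Suc m"] by simp
  then show ?case using e by (simp add: odd_poch_def[of "Suc (Suc m)"] odd_poch_def[of "Suc m"] mult.commute)
qed

lemma alt_ratio_bounds: "0 \<le> alt_ratio k" "alt_ratio k \<le> 1"
  using alt_ratio_even_odd[of "k div 2"] odd_poch_pos[of "k div 2"] odd_poch_le_1[of "k div 2"]
  by (cases "even k"; force elim!: evenE oddE)+

lemma sym_ratio_bounds: "0 \<le> sym_ratio k" "sym_ratio k \<le> 1"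
  using sym_ratio_even_odd[of "k div 2"] odd_poch_pos odd_poch_le_1
  by (cases "even k"; force elim!: evenE oddE simp: less_imp_le)+

lemma summable_x: "summable (\<lambda>i. x ^ i)"
  using x_bounds by (intro summable_geometric) auto

lemma summable_x_comp: "(\<And>i. i \<le> g i) \<Longrightarrow> summable (\<lambda>i. x ^ g i)"
  by (rule summable_comparison_test'[OF summable_x, of 0]) (use x_bounds in \<open>auto intro: power_decreasing\<close>)

text \<open>The factors are positive and differ from 1 by summable amounts, so the infinite products
  are nonzero; positive limits may later stand in denominators.\<close>

lemma poch_limits:
  shows "\<exists>e>0. even_poch \<longlonglongrightarrow> e" "\<exists>d>0. full_poch \<longlonglongrightarrow> d" "\<exists>c. odd_poch \<longlonglongrightarrow> c"
proof -
  have *: "\<exists>e>0. (\<lambda>m. \<Prod>l<m. 1 - x ^ g l) \<longlonglongrightarrow> e" if g: "\<And>l. l < g l" for g :: "nat \<Rightarrow> nat"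
  proof -
    have sm: "summable (\<lambda>l. norm ((1 - x ^ g l) - 1))"
      using summable_x_comp[of g] g x_power by (simp add: less_imp_le)
    have nz: "1 - x ^ g l \<noteq> 0" for l using x_power(3)[of "g l"] g[of l] by (auto simp: not_less_eq)
    have "prodinf (\<lambda>l. 1 - x ^ g l) \<ge> 0"
      by (rule LIMSEQ_le_const[OF prod_LIMSEQ(1)[OF sm]])
         (use x_power in \<open>auto intro!: prod_nonneg\<close>)
    then show ?thesis
      using prod_LIMSEQ[OF sm] nz by (metis less_le)
  qed
  show "\<exists>e>0. even_poch \<longlonglongrightarrow> e" unfolding even_poch_def[abs_def] by (rule *) simp
  show "\<exists>d>0. full_poch \<longlonglongrightarrow> d" unfolding full_poch_def[abs_def] by (rule *) simp
  show "\<exists>c. odd_poch \<longlonglongrightarrow> c" unfolding odd_poch_def[abs_def] using *[of "\<lambda>l. 2 * l + 1"] by auto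
qed

text \<open>This replaces the factor of the exact count by the one in the Gaussian binomial. In the
  limit \<open>full_poch (2 * m) = even_poch m * odd_poch m\<close> becomes
  \<open>d = e * c\<close>, while \<open>sym_ratio\<close> tends to \<open>c\<close>; hence
  \<open>c / d = 1 / e\<close>.\<close>

lemma sym_ratio_over_full_poch: "(\<lambda>k. sym_ratio (k - 1) / full_poch k - 1 / even_poch k) \<longlonglongrightarrow> 0"
proof -
  obtain e d c where l: "even_poch \<longlonglongrightarrow> e" "e > 0" "full_poch \<longlonglongrightarrow> d" "d > 0" "odd_poch \<longlonglongrightarrow> c"
    using poch_limits by blast
  have sm: "strict_mono (\<lambda>m::nat. 2 * m)" by (auto simp: strict_mono_def)
  have "(\<lambda>m. full_poch (2 * m)) \<longlonglongrightarrow> d" using LIMSEQ_subseq_LIMSEQ[OF l(3) sm] by (simp add: o_def)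
  moreover have "(\<lambda>m. full_poch (2 * m)) \<longlonglongrightarrow> e * c" unfolding full_poch_even by (intro tendsto_mult l)
  ultimately have dec: "d = e * c" by (rule LIMSEQ_unique)
  have "sym_ratio \<longlonglongrightarrow> c"
  proof -
    have "sym_ratio k = odd_poch (Suc k div 2)" for k
      using sym_ratio_even_odd[of "k div 2"] by (cases "even k") (auto elim!: evenE oddE)
    then have "sym_ratio = (\<lambda>k. odd_poch (Suc k div 2))" by blast
    moreover have "filterlim (\<lambda>k. Suc k div 2) at_top sequentially"
      by (rule filterlim_compose[OF filterlim_at_top_div_const_nat filterlim_Suc]) simp
    ultimately show ?thesis using filterlim_compose[OF l(5)] by simp
  qed
  then have "(\<lambda>k. sym_ratio (k - 1)) \<longlonglongrightarrow> c"
    by (subst filterlim_sequentially_Suc[symmetric]) simp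
  then have "(\<lambda>k. sym_ratio (k - 1) / full_poch k - 1 / even_poch k) \<longlonglongrightarrow> c / d - 1 / e"
    using l by (intro tendsto_intros) auto
  moreover have "c / d - 1 / e = 0" using dec l by (cases "c = 0") auto
  ultimately show ?thesis by simp
qed

text \<open>The \<open>q\<close>-binomial theorem with base \<open>x ^ 2\<close> at the argument
  \<open>x\<close>; the fraction is the Gaussian binomial coefficient. The induction uses its Pascal
  rule.\<close>

lemma q_binomial: "(\<Sum>j\<le>n. x ^ j\<^sup>2 * (even_poch n / (even_poch j * even_poch (n - j)))) = (\<Prod>i<n. 1 + x ^ (2 * i + 1))"
proof (induction n)
  case 0
  then show ?case by (simp add: even_poch_def)
next
  case (Suc n)
  \<comment> \<open>The value 0 for \<open>j > n\<close> lets the Pascal rule hold at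
    \<open>i = n\<close> as well.\<close>
  define e where "e = (\<lambda>n j. if j \<le> n then even_poch n / (even_poch j * even_poch (n - j)) else 0)"
  have E0: "even_poch 0 = 1" by (simp add: even_poch_def)
  have ES: "even_poch (Suc m) = even_poch m * (1 - x ^ (2 * m + 2))" for m by (simp add: even_poch_def)
  have Enz: "even_poch m \<noteq> 0" for m using even_poch_pos[of m] by simp
  have e0: "e m 0 = 1" for m using Enz by (simp add: e_def E0)
  have pascal: "e (Suc n) (Suc i) = e n (Suc i) + x ^ (2 * (n - i)) * e n i" if i: "i \<le> n" for i
  proof (cases "i = n")
    case True
    then show ?thesis using Enz by (simp add: e_def E0)
  next
    case False
    then obtain m where m: "n - i = Suc m" "n - Suc i = m" "Suc n - Suc i = Suc m" "Suc i \<le> n"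
      using i by (metis Suc_diff_Suc diff_Suc_Suc le_neq_implies_less Suc_leI)
    have n: "n = i + Suc m" using m by simp
    define u where "u = x ^ (2 * m + 2)"
    define v where "v = x ^ (2 * i + 2)"
    have uv: "u \<noteq> 1" "v \<noteq> 1" using x_power(3)[of "2 * m + 2"] x_power(3)[of "2 * i + 2"] by (auto simp: u_def v_def)
    have "x ^ (2 * n + 2) = u * v" unfolding n u_def v_def power_add[symmetric] by (rule arg_cong) simp
    then have "e (Suc n) (Suc i) = even_poch n * (1 - u * v) / (even_poch i * (1 - v) * (even_poch m * (1 - u)))"
      using i by (simp add: e_def m ES u_def v_def)
    moreover have "e n (Suc i) = even_poch n / (even_poch i * (1 - v) * even_poch m)"
      using m by (simp add: e_def ES v_def)
    moreover have "x ^ (2 * (n - i)) * e n i = u * (even_poch n / (even_poch i * (even_poch m * (1 - u))))"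
      using i by (simp add: e_def m ES u_def)
    moreover have "N * (1 - u * v) / (I * (1 - v) * (M * (1 - u)))
        = N / (I * (1 - v) * M) + u * (N / (I * (M * (1 - u))))"
      if "I \<noteq> 0" "M \<noteq> 0" for N I M :: real
      using that uv by (simp add: divide_simps) (simp add: algebra_simps)
    ultimately show ?thesis using Enz by simp
  qed
  have S: "(\<Sum>j\<le>m. x ^ j\<^sup>2 * (even_poch m / (even_poch j * even_poch (m - j)))) = (\<Sum>j\<le>m. x ^ j\<^sup>2 * e m j)" for m
    by (intro sum.cong) (auto simp: e_def)
  have "(\<Sum>j\<le>Suc n. x ^ j\<^sup>2 * e (Suc n) j)
      = 1 + (\<Sum>i\<le>n. x ^ (Suc i)\<^sup>2 * e (Suc n) (Suc i))"
    by (subst sum.atMost_Suc_shift) (simp add: e0)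
  also have "\<dots> = 1 + (\<Sum>i\<le>n. x ^ (Suc i)\<^sup>2 * e n (Suc i)) +
      (\<Sum>i\<le>n. x ^ (Suc i)\<^sup>2 * (x ^ (2 * (n - i)) * e n i))"
    by (simp add: pascal distrib_left sum.distrib)
  also have "1 + (\<Sum>i\<le>n. x ^ (Suc i)\<^sup>2 * e n (Suc i)) = (\<Sum>j\<le>Suc n. x ^ j\<^sup>2 * e n j)"
    by (subst sum.atMost_Suc_shift) (simp add: e0)
  also have "\<dots> = (\<Sum>j\<le>n. x ^ j\<^sup>2 * e n j)" by (simp add: e_def)
  also have "(\<Sum>i\<le>n. x ^ (Suc i)\<^sup>2 * (x ^ (2 * (n - i)) * e n i))
      = (\<Sum>i\<le>n. x ^ (2 * n + 1) * (x ^ i\<^sup>2 * e n i))"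
  proof (intro sum.cong refl)
    fix i assume "i \<in> {..n}"
    then have "(Suc i)\<^sup>2 + 2 * (n - i) = (2 * n + 1) + i\<^sup>2"
      by (simp add: power2_eq_square algebra_simps)
    then have "x ^ (Suc i)\<^sup>2 * x ^ (2 * (n - i)) = x ^ (2 * n + 1) * x ^ i\<^sup>2"
      by (simp only: flip: power_add)
    then show "x ^ (Suc i)\<^sup>2 * (x ^ (2 * (n - i)) * e n i) = x ^ (2 * n + 1) * (x ^ i\<^sup>2 * e n i)"
      by (simp only: flip: mult.assoc)
  qed
  also have "\<dots> = x ^ (2 * n + 1) * (\<Sum>j\<le>n. x ^ j\<^sup>2 * e n j)" by (simp only: sum_distrib_left)
  finally show ?case unfolding S Suc[unfolded S] by (simp add: algebra_simps)
qed

text \<open>Term by term the normalized count is compared with the expansion of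
  \<open>q_binomial\<close>. The error is a convolution of the summable weights
  \<open>x ^ j\<^sup>2\<close> with a null sequence.\<close>

lemma involution_count_asymptotics:
  fixes I :: "nat \<Rightarrow> nat \<Rightarrow> nat" and Z :: "nat \<Rightarrow> nat \<Rightarrow> nat"
  assumes I: "\<And>n k. k \<le> n \<Longrightarrow> n \<ge> 1 \<Longrightarrow> I n k * (\<Prod>i<k. q ^ k - q ^ i) =
      ((\<Prod>i<k. q ^ (2 * n - i) - q ^ i) - Z n k) * num_sym q (k - 1) + Z n k * num_alt q k"
    and Z: "\<And>n k. k \<le> n \<Longrightarrow> n \<ge> 1 \<Longrightarrow> Z n k \<le> (\<Prod>i<k. q ^ (2 * n - i) - q ^ i)"
      "\<And>n k. k \<le> n \<Longrightarrow> n \<ge> 1 \<Longrightarrow> real (Z n k) \<le> (\<Prod>i<k. 3/4 * real q ^ (2 * n - i))"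
  shows "(\<lambda>n. real (\<Sum>k\<le>n. I n k) / real q ^ n\<^sup>2) \<longlonglongrightarrow> (\<Prod>i. 1 + x ^ (2 * i + 1))"
proof -
  \<comment> \<open>The first part is the mismatch with the Gaussian binomial, the second bounds the
    effect of singular frames.\<close>
  define err where "err = (\<lambda>k. \<bar>sym_ratio (k - 1) / full_poch k - 1 / even_poch k\<bar> + (3/4) ^ k / full_poch k)"
  have q0: "real q > 0" using q by simp
  have main: "\<bar>real (I n (n - j)) / real q ^ n\<^sup>2 - x ^ j\<^sup>2 * (even_poch n / (even_poch j * even_poch (n - j)))\<bar>
      \<le> x ^ j\<^sup>2 * err (n - j)" if j: "j \<le> n" and n: "n \<ge> 1" for n j
  proof -
    define k where "k = n - j"
    have k: "k \<le> n" "n - k = j" "n = k + j" using j by (auto simp: k_def)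
    \<comment> \<open>\<open>P\<close> is the leading part of the number of frames. \<open>T\<close>
      is the number of all symmetric matrices of size \<open>k - 1\<close> and also of all
      alternating ones of size \<open>k\<close>.\<close>
    define P where "P = (\<Prod>i<k. real q ^ (2 * n - i))"
    define T where "T = real q ^ (\<Sum>i<k. i)"
    have P0: "P > 0" "T > 0" using q0 by (auto simp: P_def T_def intro!: prod_pos)
    have PT: "P * T = real q ^ (2 * n * k)"
    proof -
      have "P * T = (\<Prod>i<k. real q ^ (2 * n - i) * real q ^ i)"
        by (simp add: P_def T_def power_sum prod.distrib)
      also have "\<dots> = (\<Prod>i<k. real q ^ (2 * n))"
        using k by (intro prod.cong) (auto simp flip: power_add)
      finally show ?thesis by (simp add: power_mult)
    qed
    \<comment> \<open>The order of the general linear group of rank \<open>k\<close>.\<close>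
    have G: "real (\<Prod>i<k. q ^ k - q ^ i) = real q ^ k\<^sup>2 * full_poch k"
    proof -
      have "real (\<Prod>i<k. q ^ k - q ^ i) = (\<Prod>i<k. real q ^ k * (1 - x ^ (k - i)))"
        unfolding of_nat_prod
      proof (rule prod.cong)
        fix i assume "i \<in> {..<k}"
        then have "real q ^ k * x ^ (k - i) = real q ^ i" "q ^ i \<le> q ^ k"
          using q0 q by (auto simp: x_def power_divide field_simps simp flip: power_add intro: power_increasing)
        then show "real (q ^ k - q ^ i) = real q ^ k * (1 - x ^ (k - i))"
          by (simp add: of_nat_diff right_diff_distrib)
      qed simp
      also have "\<dots> = real q ^ (k * k) * (\<Prod>i<k. 1 - x ^ (k - i))"
        by (simp add: prod.distrib power_mult)
      also have "(\<Prod>i<k. 1 - x ^ (k - i)) = (\<Prod>i<k. 1 - x ^ Suc i)"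
        by (subst prod.nat_diff_reindex[symmetric]) (auto intro!: prod.cong simp del: power_Suc)
      finally show ?thesis by (simp add: full_poch_def power2_eq_square)
    qed
    have F: "real (\<Prod>i<k. q ^ (2 * n - i) - q ^ i) = P * (even_poch n / even_poch j)"
    proof -
      have "real (\<Prod>i<k. q ^ (2 * n - i) - q ^ i) = (\<Prod>i<k. real q ^ (2 * n - i) * (1 - x ^ (2 * n - 2 * i)))"
        unfolding of_nat_prod
      proof (rule prod.cong)
        fix i assume i: "i \<in> {..<k}"
        then have "real q ^ (2 * n - i) * x ^ (2 * n - 2 * i) = real q ^ i" "q ^ i \<le> q ^ (2 * n - i)"
          using q0 q k by (auto simp: x_def power_divide field_simps simp flip: power_add intro: power_increasing)
        then show "real (q ^ (2 * n - i) - q ^ i) = real q ^ (2 * n - i) * (1 - x ^ (2 * n - 2 * i))"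
          by (simp add: of_nat_diff right_diff_distrib)
      qed simp
      also have "\<dots> = P * (\<Prod>i<k. 1 - x ^ (2 * n - 2 * i))" by (simp add: prod.distrib P_def)
      also have "(\<Prod>i<k. 1 - x ^ (2 * n - 2 * i)) = even_poch n / even_poch j"
      proof -
        have "m \<le> n \<Longrightarrow> (\<Prod>i<m. 1 - x ^ (2 * n - 2 * i)) * even_poch (n - m) = even_poch n" for m
        proof (induction m)
          case (Suc m)
          then have "n - m = Suc (n - Suc m)" "2 * n - 2 * m = 2 * (n - Suc m) + 2" by auto
          then have "even_poch (n - m) = (1 - x ^ (2 * n - 2 * m)) * even_poch (n - Suc m)"
            by (simp only: even_poch_def prod.lessThan_Suc mult.commute)
          then show ?case using Suc by (simp add: mult.assoc)
        qed simp
        from this[OF k(1)] show ?thesis using even_poch_pos[of j] by (simp add: k field_simps)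
      qed
      finally show ?thesis .
    qed
    define z where "z = real (Z n k) / P"
    define c where "c = sym_ratio (k - 1)"
    have Zz: "real (Z n k) = z * P" using P0 by (simp add: z_def)
    have "P * (3/4) ^ k = (\<Prod>i<k. 3/4 * real q ^ (2 * n - i))"
      unfolding P_def prod.distrib by (simp add: power_divide)
    then have z: "0 \<le> z" "z \<le> (3/4) ^ k"
      using Z(2)[OF k(1) n] P0 by (auto simp: z_def field_simps)
    have cs: "real (num_sym q (k - 1)) = c * T"
      using P0 by (cases k) (simp_all add: c_def sym_ratio_def T_def)
    have ca: "real (num_alt q k) = alt_ratio k * T" using P0 by (simp add: alt_ratio_def T_def)
    have "real (I n k) * (real q ^ k\<^sup>2 * full_poch k) = (P * (even_poch n / even_poch j) - z * P) * (c * T) + z * P * (alt_ratio k * T)"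
    proof -
      have "real (I n k * (\<Prod>i<k. q ^ k - q ^ i)) =
        (real (\<Prod>i<k. q ^ (2 * n - i) - q ^ i) - real (Z n k)) * num_sym q (k - 1) + real (Z n k) * num_alt q k"
        unfolding I[OF k(1) n] using Z(1)[OF k(1) n] by (simp only: of_nat_add of_nat_mult of_nat_diff)
      then show ?thesis using cs by (simp only: of_nat_mult G F Zz ca)
    qed
    also have "\<dots> = (P * T) * (even_poch n / even_poch j * c + z * (alt_ratio k - c))" by (simp add: algebra_simps)
    finally have "real (I n k) * (real q ^ k\<^sup>2 * full_poch k) = real q ^ (2 * n * k) * (even_poch n / even_poch j * c + z * (alt_ratio k - c))"
      by (simp only: PT)
    moreover have "real q ^ (2 * n * k) = real q ^ k\<^sup>2 * (real q ^ n\<^sup>2 * x ^ j\<^sup>2)"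
    proof -
      \<comment> \<open>This is \<open>j = n - k\<close> squared, the origin of the weight
        \<open>x ^ j\<^sup>2\<close>.\<close>
      have "2 * n * k + j\<^sup>2 = k\<^sup>2 + n\<^sup>2" by (simp add: k(3) power2_eq_square algebra_simps)
      then have "real q ^ (2 * n * k) * real q ^ j\<^sup>2 = real q ^ k\<^sup>2 * real q ^ n\<^sup>2"
        by (simp only: flip: power_add)
      then show ?thesis using q0 by (simp add: x_def power_divide field_simps)
    qed
    ultimately have "real (I n k) * full_poch k = real q ^ n\<^sup>2 * (x ^ j\<^sup>2 * (even_poch n / even_poch j * c + z * (alt_ratio k - c)))"
      using q0 by (simp add: mult.left_commute)
    then have Ik: "real (I n k) / real q ^ n\<^sup>2 = x ^ j\<^sup>2 * (even_poch n / even_poch j * c + z * (alt_ratio k - c)) / full_poch k"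
      using q0 full_poch_pos[of k] by (simp add: field_simps)
    have "real (I n k) / real q ^ n\<^sup>2 - x ^ j\<^sup>2 * (even_poch n / (even_poch j * even_poch k))
        = x ^ j\<^sup>2 * (even_poch n / even_poch j * (c / full_poch k - 1 / even_poch k) + z * (alt_ratio k - c) / full_poch k)"
      unfolding Ik using even_poch_pos[of j] even_poch_pos[of k] full_poch_pos[of k] by (simp add: field_simps)
    then have "\<bar>real (I n k) / real q ^ n\<^sup>2 - x ^ j\<^sup>2 * (even_poch n / (even_poch j * even_poch k))\<bar>
        = x ^ j\<^sup>2 * \<bar>even_poch n / even_poch j * (c / full_poch k - 1 / even_poch k) + z * (alt_ratio k - c) / full_poch k\<bar>"
      using x_bounds by (simp add: abs_mult)
    also have "\<dots> \<le> x ^ j\<^sup>2 * err k"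
    proof (rule mult_left_mono)
      have "even_poch n \<le> even_poch j"
      proof -
        have "even_poch (j + m) \<le> even_poch j" for m
        proof (induction m)
          case (Suc m)
          have "even_poch (j + Suc m) = even_poch (j + m) * (1 - x ^ (2 * (j + m) + 2))" by (simp add: even_poch_def)
          also have "\<dots> \<le> even_poch (j + m) * 1"
            using even_poch_pos[of "j + m"] x_power(1)[of "2 * (j + m) + 2"] by (intro mult_left_mono) auto
          finally show ?case using Suc by simp
        qed simp
        from this[of k] show ?thesis using k(3) by (simp add: add.commute)
      qed
      then have "\<bar>even_poch n / even_poch j\<bar> \<le> 1" using even_poch_pos[of n] even_poch_pos[of j] by simp
      then have 1: "\<bar>even_poch n / even_poch j * (c / full_poch k - 1 / even_poch k)\<bar> \<le> 1 * \<bar>c / full_poch k - 1 / even_poch k\<bar>"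
        unfolding abs_mult by (intro mult_right_mono) auto
      have "\<bar>alt_ratio k - c\<bar> \<le> 1" using alt_ratio_bounds[of k] sym_ratio_bounds[of "k - 1"] by (simp add: c_def)
      then have "\<bar>z * (alt_ratio k - c)\<bar> \<le> (3/4) ^ k * 1"
        unfolding abs_mult using z by (intro mult_mono) auto
      then have 2: "\<bar>z * (alt_ratio k - c) / full_poch k\<bar> \<le> (3/4) ^ k / full_poch k"
        using full_poch_pos[of k] by (simp add: divide_right_mono)
      show "\<bar>even_poch n / even_poch j * (c / full_poch k - 1 / even_poch k) + z * (alt_ratio k - c) / full_poch k\<bar> \<le> err k"
        using 1 2 abs_triangle_ineq[of "even_poch n / even_poch j * (c / full_poch k - 1 / even_poch k)" "z * (alt_ratio k - c) / full_poch k"]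
        unfolding err_def c_def by linarith
    qed (use x_bounds in simp)
    finally show ?thesis by (simp add: k_def)
  qed
  have "err \<longlonglongrightarrow> 0"
  proof -
    obtain d where d: "full_poch \<longlonglongrightarrow> d" "d > 0" using poch_limits(2) by blast
    have "(\<lambda>k. (3/4 :: real) ^ k / full_poch k) \<longlonglongrightarrow> 0 / d"
      using d by (intro tendsto_divide LIMSEQ_power_zero) auto
    then have "err \<longlonglongrightarrow> \<bar>0\<bar> + 0 / d"
      unfolding err_def[abs_def] by (intro tendsto_add tendsto_rabs sym_ratio_over_full_poch)
    then show ?thesis by simp
  qed
  moreover have "summable (\<lambda>j. x ^ j\<^sup>2)"
    by (rule summable_x_comp) (simp add: power2_nat_le_imp_le power2_eq_square)
  ultimately have conv: "(\<lambda>n. \<Sum>j\<le>n. x ^ j\<^sup>2 * err (n - j)) \<longlonglongrightarrow> 0"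
    using x_bounds by (intro convolution_tendsto_0) auto
  have diff: "norm (real (\<Sum>k\<le>n. I n k) / real q ^ n\<^sup>2 - (\<Prod>i<n. 1 + x ^ (2 * i + 1)))
      \<le> (\<Sum>j\<le>n. x ^ j\<^sup>2 * err (n - j))" if n: "n \<ge> 1" for n
  proof -
    have "(\<Sum>k\<le>n. real (I n k)) = (\<Sum>j\<le>n. real (I n (n - j)))"
      by (rule sum.reindex_bij_witness[of _ "\<lambda>j. n - j" "\<lambda>j. n - j"]) auto
    then have "real (\<Sum>k\<le>n. I n k) / real q ^ n\<^sup>2 - (\<Prod>i<n. 1 + x ^ (2 * i + 1))
        = (\<Sum>j\<le>n. real (I n (n - j)) / real q ^ n\<^sup>2 - x ^ j\<^sup>2 * (even_poch n / (even_poch j * even_poch (n - j))))"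
      unfolding q_binomial[symmetric] by (simp add: sum_subtractf sum_divide_distrib)
    also have "norm \<dots> \<le> (\<Sum>j\<le>n. x ^ j\<^sup>2 * err (n - j))"
      by (rule sum_norm_le) (use main n in auto)
    finally show ?thesis .
  qed
  have "(\<lambda>n. real (\<Sum>k\<le>n. I n k) / real q ^ n\<^sup>2 - (\<Prod>i<n. 1 + x ^ (2 * i + 1))) \<longlonglongrightarrow> 0"
    by (rule Lim_null_comparison[OF _ conv])
       (use diff in \<open>auto simp: eventually_at_top_linorder\<close>)
  moreover have "(\<lambda>n. \<Prod>i<n. 1 + x ^ (2 * i + 1)) \<longlonglongrightarrow> (\<Prod>i. 1 + x ^ (2 * i + 1))"
    by (rule prod_LIMSEQ(1)) (use summable_x_comp[of "\<lambda>i. 2 * i + 1"] x_bounds in \<open>simp add: abs_mult\<close>)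
  ultimately show ?thesis by (rule Lim_transform[rotated])
qed

end

text \<open>Translation by 1 permutes the field, so summing all elements shows that
  \<open>CARD('k)\<close> vanishes in it; a power of 2 can vanish only if 2 does.\<close>

lemma two_eq_zero_if_card:
  assumes "CARD('k::{field,finite}) = 2 ^ m"
  shows "(2::'k) = 0"
proof -
  have "(\<Sum>y\<in>UNIV. y + 1) = (\<Sum>y\<in>UNIV. y :: 'k)"
    by (rule sum.reindex_bij_witness[of _ "\<lambda>y. y - 1" "\<lambda>y. y + 1"]) auto
  then have "of_nat CARD('k) = (0::'k)" by (simp add: sum.distrib)
  then show ?thesis using assms by simp
qed

theorem theorem5p7:
  fixes q m :: nat
    and \<epsilon> :: form_sign
    and \<nu> :: "nat \<Rightarrow> 'k::{field, finite} vec \<Rightarrow> 'k"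
  assumes "q = 2 ^ m"
    and "CARD('k) = q"
    and "\<And>n. n \<ge> 1 \<Longrightarrow> nondegenerate_quadratic_form (2 * n) (\<nu> n)"
    and "\<And>n. n \<ge> 1 \<Longrightarrow> has_sign \<epsilon> n (\<nu> n)"
  shows "(\<lambda>n. real (card (involutions (2 * n) (orthogonal_group (2 * n) (\<nu> n)))) / real q ^ (n ^ 2))
           \<longlonglongrightarrow> (\<Prod>i. 1 + 1 / real q ^ (2 * i + 1))"
proof -
  have two: "(2::'k) = 0" using assms(1,2) by (intro two_eq_zero_if_card) simp
  interpret char_two_field "TYPE('k)" q by unfold_locales (rule two assms(2))+
  let ?inv = "\<lambda>n. card (involutions (2 * n) (orthogonal_group (2 * n) (\<nu> n)))"
  \<comment> \<open>The condition \<open>n \<ge> 1\<close> sits under the quantifiers because forms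
    are given only from there on; the counts for all \<open>n\<close> are then chosen
    together.\<close>
  have "\<forall>n. \<exists>I Z. n \<ge> 1 \<longrightarrow> ?inv n = (\<Sum>k\<le>n. I k) \<and>
    (\<forall>k\<le>n. I k * (\<Prod>i<k. q ^ k - q ^ i) =
        ((\<Prod>i<k. q ^ (2 * n - i) - q ^ i) - Z k) * num_sym q (k - 1) + Z k * num_alt q k \<and>
      Z k \<le> (\<Prod>i<k. q ^ (2 * n - i) - q ^ i) \<and>
      real (Z k) \<le> (\<Prod>i<k. 3/4 * real q ^ (2 * n - i)))"
    using involution_rank_counts[OF two assms(2) assms(3)] by blast
  then obtain I Z where IZ: "\<And>n. n \<ge> 1 \<Longrightarrow> ?inv n = (\<Sum>k\<le>n. I n k) \<and>
    (\<forall>k\<le>n. I n k * (\<Prod>i<k. q ^ k - q ^ i) =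
        ((\<Prod>i<k. q ^ (2 * n - i) - q ^ i) - Z n k) * num_sym q (k - 1) + Z n k * num_alt q k \<and>
      Z n k \<le> (\<Prod>i<k. q ^ (2 * n - i) - q ^ i) \<and>
      real (Z n k) \<le> (\<Prod>i<k. 3/4 * real q ^ (2 * n - i)))"
    by (atomize_elim, simp only: choice_iff)
  have "(\<lambda>n. real (\<Sum>k\<le>n. I n k) / real q ^ n\<^sup>2) \<longlonglongrightarrow> (\<Prod>i. 1 + (1 / real q) ^ (2 * i + 1))"
    by (rule involution_count_asymptotics[where Z = Z]) (use IZ q_ge_2 in auto)
  then have "(\<lambda>n. real (?inv n) / real q ^ n\<^sup>2) \<longlonglongrightarrow> (\<Prod>i. 1 + (1 / real q) ^ (2 * i + 1))"
    by (rule Lim_transform_eventually) (use IZ in \<open>auto simp: eventually_at_top_linorder intro!: exI[of _ 1]\<close>)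
  then show ?thesis by (simp only: power_one_over)
qed

end
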